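(* Let $K\ge1$, $0=\tau_0<\tau_1<\dots<\tau_K$, $I_i=[-\tau_i,-\tau_{i-1}]$, $\Delta\tau_i=\tau_i-\tau_{i-1}$, let $f:(\mathbb R^n)^{K+1}\to\mathbb R^n$ be continuous with $f(0,\dots,0)=0$, and let $d\ge0$ be an even integer. Suppose there exist $g\in\tilde\Xi_1^d$, $h,\hat h\in\tilde\Xi_2^d$ and $\hat g$ with $-\hat g\in\tilde\Xi_3^d$, with pieces $g=\Delta\tau_i\,g_i$ and $\hat g=\hat g_i$ for $\theta\in I_i$, and $h=h_{ij}$, $\hat h=\hat h_{ij}$ for $\theta\in I_i,\ \omega\in I_j$, such that for all $i,j=1,\dots,K$, all $y_0,\dots,y_K,x,x'\in\mathbb R^n$ and all $\theta\in I_i$, $\omega\in I_j$, $$\begin{aligned}\hat g_i(y_0,\dots,y_K,x,\theta)=\;&g_i(y_0,y_{i-1},-\tau_{i-1})-g_i(y_0,y_i,-\tau_i)\\&+\Delta\tau_i\,\nabla_1g_i(y_0,x,\theta)^Tf(y_0,\dots,y_K)-\Delta\tau_i\frac{\partial}{\partial\theta}g_i(y_0,x,\theta)\\&+\sum_{k=1}^K\big(h_{ki}(y_{k-1},x,-\tau_{k-1},\theta)-h_{ki}(y_k,x,-\tau_k,\theta)\big)\\&+\sum_{k=1}^K\big(h_{ik}(x,y_{k-1},\theta,-\tau_{k-1})-h_{ik}(x,y_k,\theta,-\tau_k)\big),\end{aligned}$$ $$\hat h_{ij}(x,x',\theta,\omega)=\frac{\partial}{\partial\theta}h_{ij}(x,x',\theta,\omega)+\frac{\partial}{\partial\omega}h_{ij}(x,x',\theta,\omega),$$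 where $\nabla_1$ is the gradient with respect to the first vector argument. Then the time-delay system $\dot x(t)=f(x(t),x(t-\tau_1),\dots,x(t-\tau_K))$ is globally asymptotically stable.
   Context: $\Sigma_s$ denotes the set of polynomials that are finite sums of squares of real polynomials (in all the variables involved, including $\theta$). Piecewise functions are identified with their families of polynomial pieces. $\tilde\Xi_1^d$: functions $g(x_1,x_2,\theta)$ for which there exist polynomials $q_i(x_1,x_2,\theta)$, $t_i(x_1,\theta)$, $i=1,\dots,K$, of degree at most $d$, and $\alpha>0$, with $q_i(x_1,x_2,\theta)-t_i(x_1,\theta)-\alpha\|x_1\|^2\in\Sigma_s$, $g=q_i$ for $\theta\in I_i$, and $\sum_{i=1}^K\int_{-\tau_i}^{-\tau_{i-1}}t_i(x_1,\theta)\,d\theta=0$ for all $x_1$. $\tilde\Xi_3^d$: functions $q(x_1,\dots,x_{K+2},\theta)$ for which there exist polynomials $q_i(x_1,\dots,x_{K+2},\theta)$, $t_i(x_1,\dots,x_{K+1},\theta)$ of degree at most $d$, and $\alpha>0$, with $q_i-t_i-\alpha\|x_1\|^2\in\Sigma_s$, $q=q_i$ for $\theta\in I_i$, and $\sum_{i=1}^K\int_{-\tau_i}^{-\tau_{i-1}}t_i(x_1,\dots,x_{K+1},\theta)\,d\theta=0$ for all $x_1,\dots,x_{K+1}$. $\tilde\Xi_2^{2m}$ (here $d=2m$): functions $h(x_1,x_2,\theta,\omega)$ whose pieces $h_{ij}$ on $\theta\in I_i,\omega\in I_j$ are polynomials of degree at most $2m$ of the form $h_{ij}(x_1,x_2,\theta,\omega)=Z_m(x_1)^TR_{ij}(\theta,\omega)Z_m(x_2)$,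 where $Z_m(x)$ is the vector of all $N=\binom{n+m}{m}$ monomials in $x\in\mathbb R^n$ of degree at most $m$, and the $N\times N$ matrices $R_{ij}$ arise as follows: there is a positive semidefinite real symmetric $Q_0$ of size $NK(m+1)$ such that, with $\bar Z(\theta)=I_{NK}\otimes(1,\theta,\dots,\theta^m)^T$ and $\hat R(\theta,\omega)=\bar Z(\theta)^TQ_0\bar Z(\omega)$ partitioned into $N\times N$ blocks $\hat R_{ij}$, $R_{ij}(\theta,\omega)=\hat R_{ij}\big(\tfrac{\tau_K}{\Delta\tau_i}(\theta+\tau_{i-1}),\tfrac{\tau_K}{\Delta\tau_j}(\omega+\tau_{j-1})\big)$. $\mathcal C_{\tau_K}$ is the space of continuous functions $[-\tau_K,0]\to\mathbb R^n$ with supremum norm. It is assumed that for each $\phi\in\mathcal C_{\tau_K}$ the equation has a unique solution on $[-\tau_K,\infty)$ with $x=\phi$ on $[-\tau_K,0]$. Globally asymptotically stable means: every solution is bounded; for every $\varepsilon>0$ there is $\delta>0$ such that $\|\phi\|<\delta$ implies $\sup_{t\ge-\tau_K}\|x(t)\|<\varepsilon$; and every solution satisfies $\lim_{t\to\infty}x(t)=0$. *)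

theory Defs
  imports "HOL-Analysis.Analysis" "HOL-Library.Poly_Mapping"
begin

section \<open>Real polynomials in several variables\<close>

text \<open>Polynomials are formal: finitely supported real-valued functions on monomials, with the
  convolution product provided by \<open>HOL-Library.Poly_Mapping\<close>.\<close>

type_synonym 'v rpoly = "('v \<Rightarrow>\<^sub>0 nat) \<Rightarrow>\<^sub>0 real"

definition rpoly_const :: "real \<Rightarrow> 'v rpoly" where
  "rpoly_const c = Poly_Mapping.single 0 c"

definition rpoly_var :: "'v \<Rightarrow> 'v rpoly" where
  "rpoly_var v = Poly_Mapping.single (Poly_Mapping.single v 1) 1"

definition rpoly_eval :: "'v rpoly \<Rightarrow> ('v \<Rightarrow> real) \<Rightarrow> real" where
  "rpoly_eval p a = (\<Sum>m\<in>Poly_Mapping.keys p.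
     Poly_Mapping.lookup p m * (\<Prod>v\<in>Poly_Mapping.keys m. a v ^ Poly_Mapping.lookup m v))"

definition rpoly_vars :: "'v rpoly \<Rightarrow> 'v set" where
  "rpoly_vars p = (\<Union>m\<in>Poly_Mapping.keys p. Poly_Mapping.keys m)"

definition total_degree_le :: "'v rpoly \<Rightarrow> nat \<Rightarrow> bool" where
  "total_degree_le p d \<longleftrightarrow> (\<forall>m\<in>Poly_Mapping.keys p.
     (\<Sum>v\<in>Poly_Mapping.keys m. Poly_Mapping.lookup m v) \<le> d)"

definition rpolys :: "'v set \<Rightarrow> nat \<Rightarrow> 'v rpoly set" where
  "rpolys V d = {p. rpoly_vars p \<subseteq> V \<and> total_degree_le p d}"

definition sos :: "'v set \<Rightarrow> 'v rpoly set" where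
  "sos V = {p. \<exists>rs. (\<forall>r\<in>set rs. rpoly_vars r \<subseteq> V) \<and> p = (\<Sum>r\<leftarrow>rs. r ^ 2)}"

text \<open>\<open>X k c\<close> is the \<open>c\<close>-th coordinate of the vector variable \<open>x\<^sub>k\<close> (numbered from 1).\<close>

datatype 'n indet = X nat 'n | Theta | Omega

definition vector_vars :: "nat \<Rightarrow> 'n indet set" where
  "vector_vars k = {X j c | j c. 1 \<le> j \<and> j \<le> k}"

definition sq_norm_x1 :: "'n::finite indet rpoly" where
  "sq_norm_x1 = (\<Sum>c\<in>UNIV. rpoly_var (X 1 c) ^ 2)"

fun indet_val :: "(nat \<Rightarrow> real ^ 'n) \<Rightarrow> real \<Rightarrow> real \<Rightarrow> 'n indet \<Rightarrow> real" where
  "indet_val x \<theta> \<omega> (X k c) = x k $ c"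
| "indet_val x \<theta> \<omega> Theta = \<theta>"
| "indet_val x \<theta> \<omega> Omega = \<omega>"

definition eval2 :: "'n indet rpoly \<Rightarrow> (nat \<Rightarrow> real ^ 'n) \<Rightarrow> real \<Rightarrow> real \<Rightarrow> real" where
  "eval2 p x \<theta> \<omega> = rpoly_eval p (indet_val x \<theta> \<omega>)"

text \<open>Used only for polynomials not involving \<open>\<omega>\<close>.\<close>

abbreviation eval1 :: "'n indet rpoly \<Rightarrow> (nat \<Rightarrow> real ^ 'n) \<Rightarrow> real \<Rightarrow> real" where
  "eval1 p x \<theta> \<equiv> eval2 p x \<theta> 0"

definition two_args :: "'a \<Rightarrow> 'a \<Rightarrow> nat \<Rightarrow> 'a" where
  "two_args a b = (\<lambda>k. if k = 1 then a else b)"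

definition grad :: "(real ^ 'n \<Rightarrow> real) \<Rightarrow> real ^ 'n \<Rightarrow> real ^ 'n" where
  "grad F a = (THE D. GDERIV F a :> D)"


section \<open>The classes of polynomial pieces\<close>

definition delay_interval :: "(nat \<Rightarrow> real) \<Rightarrow> nat \<Rightarrow> real set" where
  "delay_interval \<tau> i = {- \<tau> i .. - \<tau> (i - 1)}"

text \<open>A piecewise function is the family of its pieces, indexed by \<open>{1..K}\<close> (values of the family
  at other indices play no role).  \<open>Xi_gen l\<close> has pieces in \<open>x\<^sub>1, \<dots>, x\<^bsub>l+1\<^esub>, \<theta>\<close>,
  and the auxiliary \<open>t\<^sub>i\<close> do not involve \<open>x\<^bsub>l+1\<^esub>\<close>.\<close>

definition Xi_gen ::
  "nat \<Rightarrow> nat \<Rightarrow> (nat \<Rightarrow> real) \<Rightarrow> nat \<Rightarrow> (nat \<Rightarrow> 'n::finite indet rpoly) set" where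
  "Xi_gen l K \<tau> d = {q. \<exists>t \<alpha>. \<alpha> > 0 \<and>
     (\<forall>i\<in>{1..K}.
        q i \<in> rpolys (insert Theta (vector_vars (l + 1))) d \<and>
        t i \<in> rpolys (insert Theta (vector_vars l)) d \<and>
        q i - t i - rpoly_const \<alpha> * sq_norm_x1
          \<in> sos (insert Theta (vector_vars (l + 1)))) \<and>
     (\<forall>x. (\<Sum>i=1..K. integral (delay_interval \<tau> i) (\<lambda>\<theta>. eval1 (t i) x \<theta>)) = 0)}"

definition Xi1 :: "nat \<Rightarrow> (nat \<Rightarrow> real) \<Rightarrow> nat \<Rightarrow> (nat \<Rightarrow> 'n::finite indet rpoly) set" where
  "Xi1 K = Xi_gen 1 K"

definition Xi3 :: "nat \<Rightarrow> (nat \<Rightarrow> real) \<Rightarrow> nat \<Rightarrow> (nat \<Rightarrow> 'n::finite indet rpoly) set" where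
  "Xi3 K = Xi_gen (K + 1) K"

text \<open>Matrices are indexed by finite sets instead of by numbers: the entries of \<open>Z\<^sub>m\<close> by exponent
  vectors, the \<open>NK\<close> rows of \<open>\<hat>R\<close> by pairs (block, exponent vector), and the \<open>NK(m+1)\<close> rows of
  \<open>Q\<^sub>0\<close> by such a pair together with a power of \<open>\<theta>\<close>.\<close>

definition exponents :: "nat \<Rightarrow> ('n::finite \<Rightarrow> nat) set" where
  "exponents m = {e. (\<Sum>c\<in>UNIV. e c) \<le> m}"

definition Z_vec :: "real ^ 'n \<Rightarrow> ('n::finite \<Rightarrow> nat) \<Rightarrow> real" where
  "Z_vec x e = (\<Prod>c\<in>UNIV. (x $ c) ^ e c)"

definition Q_index :: "nat \<Rightarrow> nat \<Rightarrow> ((nat \<times> ('n::finite \<Rightarrow> nat)) \<times> nat) set" where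
  "Q_index K m = ({1..K} \<times> exponents m) \<times> {0..m}"

definition psd_on :: "'a set \<Rightarrow> ('a \<Rightarrow> 'a \<Rightarrow> real) \<Rightarrow> bool" where
  "psd_on U Q \<longleftrightarrow> (\<forall>u\<in>U. \<forall>v\<in>U. Q u v = Q v u) \<and>
     (\<forall>z. (\<Sum>u\<in>U. \<Sum>v\<in>U. z u * Q u v * z v) \<ge> 0)"

text \<open>Entries of the Kronecker product of an identity matrix and \<open>(1, \<theta>, \<dots>, \<theta>\<^sup>m)\<^sup>T\<close>.\<close>

definition Z_bar :: "real \<Rightarrow> 'p \<times> nat \<Rightarrow> 'p \<Rightarrow> real" where
  "Z_bar \<theta> u p = (if fst u = p then \<theta> ^ snd u else 0)"

definition R_hat ::
  "nat \<Rightarrow> nat \<Rightarrow> ((nat \<times> ('n::finite \<Rightarrow> nat)) \<times> nat \<Rightarrow> (nat \<times> ('n \<Rightarrow> nat)) \<times> nat \<Rightarrow> real) \<Rightarrow>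
     real \<Rightarrow> real \<Rightarrow> nat \<times> ('n \<Rightarrow> nat) \<Rightarrow> nat \<times> ('n \<Rightarrow> nat) \<Rightarrow> real" where
  "R_hat K m Q \<theta> \<omega> p p' =
     (\<Sum>u\<in>Q_index K m. \<Sum>v\<in>Q_index K m. Z_bar \<theta> u p * Q u v * Z_bar \<omega> v p')"

definition rescale :: "nat \<Rightarrow> (nat \<Rightarrow> real) \<Rightarrow> nat \<Rightarrow> real \<Rightarrow> real" where
  "rescale K \<tau> i \<theta> = \<tau> K / (\<tau> i - \<tau> (i - 1)) * (\<theta> + \<tau> (i - 1))"

definition Xi2 ::
  "nat \<Rightarrow> (nat \<Rightarrow> real) \<Rightarrow> nat \<Rightarrow> (nat \<Rightarrow> nat \<Rightarrow> 'n::finite indet rpoly) set" where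
  "Xi2 K \<tau> d = {h. \<exists>m Q. d = 2 * m \<and> psd_on (Q_index K m) Q \<and>
     (\<forall>i\<in>{1..K}. \<forall>j\<in>{1..K}.
        h i j \<in> rpolys ({Theta, Omega} \<union> vector_vars 2) (2 * m) \<and>
        (\<forall>x1 x2 \<theta> \<omega>. eval2 (h i j) (two_args x1 x2) \<theta> \<omega> =
           (\<Sum>e\<in>exponents m. \<Sum>e'\<in>exponents m.
              Z_vec x1 e * R_hat K m Q (rescale K \<tau> i \<theta>) (rescale K \<tau> j \<omega>) (i, e) (j, e')
                * Z_vec x2 e')))}"


section \<open>Time-delay systems\<close>

text \<open>A point of \<open>(\<real>\<^sup>n)\<^bsup>K+1\<^esup>\<close> is an extensional function on \<open>{0..K}\<close>.\<close>

definition is_solution ::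
  "nat \<Rightarrow> (nat \<Rightarrow> real) \<Rightarrow> ((nat \<Rightarrow> real ^ 'n) \<Rightarrow> real ^ 'n::finite) \<Rightarrow>
     (real \<Rightarrow> real ^ 'n) \<Rightarrow> (real \<Rightarrow> real ^ 'n) \<Rightarrow> bool" where
  "is_solution K \<tau> f \<phi> x \<longleftrightarrow>
     (\<forall>t\<in>{- \<tau> K .. 0}. x t = \<phi> t) \<and>
     (\<forall>t\<ge>0. (x has_vector_derivative f (\<lambda>k\<in>{0..K}. x (t - \<tau> k))) (at t within {0..}))"

definition uniquely_solvable ::
  "nat \<Rightarrow> (nat \<Rightarrow> real) \<Rightarrow> ((nat \<Rightarrow> real ^ 'n) \<Rightarrow> real ^ 'n::finite) \<Rightarrow> bool" where
  "uniquely_solvable K \<tau> f \<longleftrightarrow> (\<forall>\<phi>. continuous_on {- \<tau> K .. 0} \<phi> \<longrightarrow>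
     (\<exists>x. is_solution K \<tau> f \<phi> x) \<and>
     (\<forall>x x'. is_solution K \<tau> f \<phi> x \<longrightarrow> is_solution K \<tau> f \<phi> x' \<longrightarrow> (\<forall>t\<ge>- \<tau> K. x t = x' t)))"

text \<open>The first clause makes the supremum in the second one range over a bounded set.\<close>

definition globally_asymptotically_stable ::
  "nat \<Rightarrow> (nat \<Rightarrow> real) \<Rightarrow> ((nat \<Rightarrow> real ^ 'n) \<Rightarrow> real ^ 'n::finite) \<Rightarrow> bool" where
  "globally_asymptotically_stable K \<tau> f \<longleftrightarrow>
     (\<forall>\<phi> x. continuous_on {- \<tau> K .. 0} \<phi> \<longrightarrow> is_solution K \<tau> f \<phi> x \<longrightarrow>
        bounded (x ` {- \<tau> K ..})) \<and>
     (\<forall>\<epsilon>>0. \<exists>\<delta>>0. \<forall>\<phi> x. continuous_on {- \<tau> K .. 0} \<phi> \<longrightarrow> is_solution K \<tau> f \<phi> x \<longrightarrow>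
        (SUP s\<in>{- \<tau> K .. 0}. norm (\<phi> s)) < \<delta> \<longrightarrow> (SUP t\<in>{- \<tau> K ..}. norm (x t)) < \<epsilon>) \<and>
     (\<forall>\<phi> x. continuous_on {- \<tau> K .. 0} \<phi> \<longrightarrow> is_solution K \<tau> f \<phi> x \<longrightarrow>
        (x \<longlongrightarrow> 0) at_top)"

end

theory Submission
  imports Defs
begin

text \<open>
  The system is stable because it has a complete Lyapunov--Krasovskii functional, namely
  \<open>V \<psi> = \<Sum>\<^sub>i \<integral> \<Delta>\<tau>\<^sub>i g\<^sub>i(\<psi> 0, \<psi> \<theta>, \<theta>) d\<theta>
       + \<Sum>\<^sub>i\<^sub>j \<integral>\<integral> h\<^sub>i\<^sub>j(\<psi> \<theta>, \<psi> \<omega>, \<theta>, \<omega>) d\<omega> d\<theta>\<close>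
  with \<open>\<theta>\<close> in the \<open>i\<close>-th and \<open>\<omega>\<close> in the \<open>j\<close>-th delay interval.

  \<^item> Membership of \<open>\<Delta>\<tau>\<^sub>i g\<^sub>i\<close> in the first class bounds the single integrals below by a multiple of
    \<open>|\<psi> 0|\<^sup>2\<close>: a sum of squares is nonnegative, and the spacing functions \<open>t\<^sub>i\<close> integrate to zero
    (\<open>Xi_gen_integral_lower\<close>).  Membership of \<open>h\<close> in the second class makes the double integrals
    the value of a positive semidefinite quadratic form at a vector of moments of \<open>\<psi>\<close>
    (\<open>Xi2_double_integral_nonneg\<close>).
  \<^item> Along a solution \<open>x\<close>, the derivative of \<open>V\<close> is the sum of the integrals of
    \<open>ghat\<^sub>i(x t, x (t - \<tau>\<^sub>1), \<dots>, x (t - \<tau>\<^sub>K), x (t + \<theta>), \<theta>)\<close> minus the double integrals of \<open>hhat\<^sub>i\<^sub>j\<close>;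
    this is what the two relations between \<open>g\<close>, \<open>h\<close>, \<open>ghat\<close> and \<open>hhat\<close> encode.  The two estimates
    above, applied to \<open>- ghat\<close> and \<open>hhat\<close>, then bound it by a negative multiple of \<open>|x t|\<^sup>2\<close>.

  The differentiation under the integrals reduces to one-dimensional windows: a polynomial is
  a finite sum of products of functions of one argument each, so that \<open>V\<close> is a polynomial
  expression in \<open>x t\<close> and in moments \<open>\<integral> q(x (t + \<theta>)) \<theta>\<^sup>j d\<theta>\<close> over fixed intervals
  (locale \<open>separated\<close>).

  The passage from \<open>V\<close> to stability (locale \<open>lyapunov_krasovskii\<close>) has one subtle point:
  the polynomials may have constant terms, so that \<open>V\<close> need not vanish at \<open>0\<close> and the lower bound
  alone does not give stability.  Together with the decay of \<open>V\<close> it does give boundedness, and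
  for a bounded velocity the decay of \<open>V\<close> forces \<open>x \<longlongrightarrow> 0\<close>.  By continuity of \<open>V\<close> at \<open>0\<close> it
  follows that \<open>V\<close> stays above \<open>V 0\<close> along every solution.  Stability is then an energy argument: a solution that starts near \<open>0\<close> has only
  little energy \<open>V - V 0\<close> to spend, whereas an excursion to distance \<open>\<epsilon>\<close> costs a fixed
  amount (\<open>energy_drop\<close>).
\<close>

section \<open>Evaluation of polynomials is a ring homomorphism\<close>

definition monom_eval :: "('v \<Rightarrow>\<^sub>0 nat) \<Rightarrow> ('v \<Rightarrow> real) \<Rightarrow> real" where
  "monom_eval m a = (\<Prod>v\<in>Poly_Mapping.keys m. a v ^ Poly_Mapping.lookup m v)"

lemma monom_eval_superset:
  assumes "finite S" "Poly_Mapping.keys m \<subseteq> S"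
  shows "monom_eval m a = (\<Prod>v\<in>S. a v ^ Poly_Mapping.lookup m v)"
  unfolding monom_eval_def using assms
  by (intro prod.mono_neutral_left) (auto simp: in_keys_iff)

lemma monom_eval_add: "monom_eval (m + n) a = monom_eval m a * monom_eval n a"
proof -
  let ?S = "Poly_Mapping.keys m \<union> Poly_Mapping.keys n"
  have "monom_eval (m + n) a = (\<Prod>v\<in>?S. a v ^ Poly_Mapping.lookup (m + n) v)"
    by (intro monom_eval_superset) (auto dest: subsetD[OF Poly_Mapping.keys_add])
  also have "\<dots> = monom_eval m a * monom_eval n a"
    by (simp add: monom_eval_superset[of ?S] lookup_add power_add prod.distrib)
  finally show ?thesis .
qed

lemma rpoly_eval_superset:
  assumes "finite S" "Poly_Mapping.keys p \<subseteq> S"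
  shows "rpoly_eval p a = (\<Sum>m\<in>S. Poly_Mapping.lookup p m * monom_eval m a)"
  unfolding rpoly_eval_def monom_eval_def using assms
  by (intro sum.mono_neutral_left) (auto simp: in_keys_iff)

lemma rpoly_eval_add: "rpoly_eval (p + q) a = rpoly_eval p a + rpoly_eval q a"
proof -
  let ?S = "Poly_Mapping.keys p \<union> Poly_Mapping.keys q"
  have "rpoly_eval (p + q) a = (\<Sum>m\<in>?S. Poly_Mapping.lookup (p + q) m * monom_eval m a)"
    by (intro rpoly_eval_superset) (auto dest: subsetD[OF Poly_Mapping.keys_add])
  also have "\<dots> = rpoly_eval p a + rpoly_eval q a"
    by (simp add: rpoly_eval_superset[of ?S] lookup_add ring_distribs sum.distrib)
  finally show ?thesis .
qed

lemma rpoly_eval_zero: "rpoly_eval 0 a = 0"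
  by (simp add: rpoly_eval_def)

lemma rpoly_eval_single: "rpoly_eval (Poly_Mapping.single m c) a = c * monom_eval m a"
  by (simp add: rpoly_eval_superset[of "{m}"])

lemma rpoly_eval_sum: "rpoly_eval (\<Sum>i\<in>S. p i) a = (\<Sum>i\<in>S. rpoly_eval (p i) a)"
  by (induction S rule: infinite_finite_induct) (auto simp: rpoly_eval_zero rpoly_eval_add)

lemma rpoly_eval_diff: "rpoly_eval (p - q) a = rpoly_eval p a - rpoly_eval q a"
  using rpoly_eval_add[of "p - q" q a] by simp

lemma rpoly_eval_uminus: "rpoly_eval (- p) a = - rpoly_eval p a"
  using rpoly_eval_diff[of 0 p a] by (simp add: rpoly_eval_zero)

lemma rpoly_as_sum_single:
  "(p :: 'v rpoly) = (\<Sum>m\<in>Poly_Mapping.keys p. Poly_Mapping.single m (Poly_Mapping.lookup p m))"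
  by (rule poly_mapping_eqI) (simp add: lookup_sum lookup_single when_def in_keys_iff)

lemma rpoly_eval_mult: "rpoly_eval (p * q) a = rpoly_eval p a * rpoly_eval q a"
proof -
  have "p * q = (\<Sum>m\<in>Poly_Mapping.keys p. \<Sum>n\<in>Poly_Mapping.keys q.
      Poly_Mapping.single (m + n) (Poly_Mapping.lookup p m * Poly_Mapping.lookup q n))"
    by (subst rpoly_as_sum_single[of p], subst rpoly_as_sum_single[of q])
       (simp add: sum_product mult_single)
  then have "rpoly_eval (p * q) a = (\<Sum>m\<in>Poly_Mapping.keys p. \<Sum>n\<in>Poly_Mapping.keys q.
      (Poly_Mapping.lookup p m * monom_eval m a) * (Poly_Mapping.lookup q n * monom_eval n a))"
    by (simp add: rpoly_eval_sum rpoly_eval_single monom_eval_add mult_ac)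
  also have "\<dots> = rpoly_eval p a * rpoly_eval q a"
    by (simp add: rpoly_eval_superset[OF _ subset_refl] sum_product)
  finally show ?thesis .
qed

lemma rpoly_eval_const: "rpoly_eval (rpoly_const c) a = c"
  by (simp add: rpoly_const_def rpoly_eval_single monom_eval_def)

lemma rpoly_eval_var: "rpoly_eval (rpoly_var v) a = a v"
  by (simp add: rpoly_var_def rpoly_eval_single monom_eval_def)

lemma eval2_sq_norm_x1: "eval2 sq_norm_x1 x \<theta> \<omega> = (norm (x 1))\<^sup>2"
  by (simp add: eval2_def sq_norm_x1_def rpoly_eval_sum rpoly_eval_mult rpoly_eval_var
      power2_eq_square power2_norm_eq_inner[unfolded power2_eq_square] inner_vec_def)

lemma rpoly_eval_sos_nonneg:
  assumes "p \<in> sos V" shows "rpoly_eval p a \<ge> 0"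
proof -
  obtain rs where p: "p = (\<Sum>r\<leftarrow>rs. r ^ 2)"
    using assms by (auto simp: sos_def)
  have "rpoly_eval (\<Sum>r\<leftarrow>rs. r ^ 2) a \<ge> 0"
    by (induction rs) (auto simp: rpoly_eval_zero rpoly_eval_add power2_eq_square rpoly_eval_mult)
  then show ?thesis by (simp add: p)
qed

lemma rpoly_eval_cong:
  assumes "\<And>v. v \<in> rpoly_vars p \<Longrightarrow> a v = b v"
  shows "rpoly_eval p a = rpoly_eval p b"
  unfolding rpoly_eval_def using assms
  by (intro sum.cong arg_cong2[where f = "(*)"] prod.cong refl) (force simp: rpoly_vars_def)

text \<open>The spacing functions \<open>t\<^sub>i\<close> do not see the last vector variable; this is how they become functions
  of a point that is constant during the integration over \<open>\<theta>\<close>.\<close>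

lemma eval1_cong_vector_vars:
  assumes "p \<in> rpolys (insert Theta (vector_vars l)) d"
    and "\<And>k. 1 \<le> k \<Longrightarrow> k \<le> l \<Longrightarrow> x k = x' k"
  shows "eval1 p x \<theta> = eval1 p x' \<theta>"
  unfolding eval2_def
  by (rule rpoly_eval_cong) (use assms in \<open>auto simp: rpolys_def vector_vars_def\<close>)

section \<open>Separation of variables\<close>

text \<open>The second factor collects every vector variable except \<open>x\<^sub>1\<close>, because \<open>two_args a b\<close> assigns \<open>b\<close>
  to all of them.  So the factorisation below holds for every polynomial, whatever its variables.\<close>

definition monom_fst :: "('n::finite indet \<Rightarrow>\<^sub>0 nat) \<Rightarrow> real ^ 'n \<Rightarrow> real" where
  "monom_fst m z = (\<Prod>v\<in>Poly_Mapping.keys m.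
     case v of X k c \<Rightarrow> if k = 1 then (z $ c) ^ Poly_Mapping.lookup m v else 1 | _ \<Rightarrow> 1)"

definition monom_snd :: "('n::finite indet \<Rightarrow>\<^sub>0 nat) \<Rightarrow> real ^ 'n \<Rightarrow> real" where
  "monom_snd m z = (\<Prod>v\<in>Poly_Mapping.keys m.
     case v of X k c \<Rightarrow> if k = 1 then 1 else (z $ c) ^ Poly_Mapping.lookup m v | _ \<Rightarrow> 1)"

lemma real_polynomial_function_nth: "real_polynomial_function (\<lambda>z::real ^ 'n. z $ c)"
  by (rule real_polynomial_function.intros(1)) (rule bounded_linear_vec_nth)

lemma real_polynomial_function_monom_fst:
  fixes m :: "'n::finite indet \<Rightarrow>\<^sub>0 nat"
  shows "real_polynomial_function (monom_fst m)"
  unfolding monom_fst_def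
proof (rule real_polynomial_function_prod)
  show "real_polynomial_function (\<lambda>z::real ^ 'n. case v of X k c \<Rightarrow> if k = 1 then (z $ c) ^ Poly_Mapping.lookup m v else 1 | _ \<Rightarrow> 1)" for v
  proof (cases v)
    case (X k c)
    then show ?thesis
      by (cases "k = 1") (auto intro: real_polynomial_function_power real_polynomial_function_nth)
  qed auto
qed simp

lemma real_polynomial_function_monom_snd:
  fixes m :: "'n::finite indet \<Rightarrow>\<^sub>0 nat"
  shows "real_polynomial_function (monom_snd m)"
  unfolding monom_snd_def
proof (rule real_polynomial_function_prod)
  show "real_polynomial_function (\<lambda>z::real ^ 'n. case v of X k c \<Rightarrow> if k = 1 then 1 else (z $ c) ^ Poly_Mapping.lookup m v | _ \<Rightarrow> 1)" for v
  proof (cases v)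
    case (X k c)
    then show ?thesis
      by (cases "k = 1") (auto intro: real_polynomial_function_power real_polynomial_function_nth)
  qed auto
qed simp

lemma eval2_two_args_separated:
  "eval2 p (two_args a b) \<theta> \<omega> = (\<Sum>m\<in>Poly_Mapping.keys p. Poly_Mapping.lookup p m *
     (monom_fst m a * monom_snd m b * \<theta> ^ Poly_Mapping.lookup m Theta * \<omega> ^ Poly_Mapping.lookup m Omega))"
proof -
  have "monom_eval m (indet_val (two_args a b) \<theta> \<omega>) =
      monom_fst m a * monom_snd m b * \<theta> ^ Poly_Mapping.lookup m Theta * \<omega> ^ Poly_Mapping.lookup m Omega" for m
  proof -
    let ?T = "\<lambda>v. if v = Theta then \<theta> ^ Poly_Mapping.lookup m v else 1"
    let ?O = "\<lambda>v. if v = Omega then \<omega> ^ Poly_Mapping.lookup m v else 1"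
    have T: "(\<Prod>v\<in>Poly_Mapping.keys m. ?T v) = \<theta> ^ Poly_Mapping.lookup m Theta"
      by (simp add: in_keys_iff)
    have O: "(\<Prod>v\<in>Poly_Mapping.keys m. ?O v) = \<omega> ^ Poly_Mapping.lookup m Omega"
      by (simp add: in_keys_iff)
    show ?thesis
      unfolding monom_eval_def monom_fst_def monom_snd_def T[symmetric] O[symmetric]
        prod.distrib[symmetric]
      by (intro prod.cong refl) (auto split: indet.split simp: two_args_def)
  qed
  then show ?thesis
    by (simp add: eval2_def rpoly_eval_superset[OF _ subset_refl])
qed

section \<open>Integrals over a moving window\<close>

text \<open>The function \<open>y\<close> is only continuous, so one cannot differentiate under the integral directly.
  Integrating by parts first replaces \<open>y\<close> by an antiderivative \<open>Y\<close>, which is continuously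
  differentiable.\<close>

lemma has_real_derivative_window_integral:
  fixes y w w' :: "real \<Rightarrow> real"
  assumes y: "continuous_on UNIV y"
    and w: "\<And>\<theta>. (w has_real_derivative w' \<theta>) (at \<theta>)" and w': "continuous_on UNIV w'"
    and ab: "a \<le> b"
  shows "((\<lambda>t. integral {a..b} (\<lambda>\<theta>. y (t + \<theta>) * w \<theta>)) has_real_derivative
     y (t + b) * w b - y (t + a) * w a - integral {a..b} (\<lambda>\<theta>. y (t + \<theta>) * w' \<theta>)) (at t)"
proof -
  have "\<exists>Y. \<forall>s::real. -\<infinity> < ereal s \<longrightarrow> ereal s < \<infinity> \<longrightarrow> (Y has_vector_derivative y s) (at s)"
    by (rule einterval_antiderivative) (use y in \<open>auto simp: continuous_on_eq_continuous_at\<close>)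
  then obtain Y where Y: "\<And>s. (Y has_real_derivative y s) (at s)"
    by (auto simp: has_real_derivative_iff_has_vector_derivative)
  have Y1: "((\<lambda>t. Y (t + \<theta>)) has_real_derivative y (t + \<theta>)) (at t)" for t \<theta>
    using Y[of "t + \<theta>"] by (simp add: DERIV_shift)
  have Y2: "((\<lambda>\<theta>. Y (t + \<theta>)) has_real_derivative y (t + \<theta>)) (at \<theta>)" for t \<theta>
    using Y1[where t = \<theta> and \<theta> = t] by (simp add: add.commute)
  have contY: "continuous_on UNIV Y"
    by (rule DERIV_continuous_on) (use Y in auto)
  note [continuous_intros] = continuous_on_compose2[OF contY _ subset_UNIV]
    continuous_on_compose2[OF y _ subset_UNIV] continuous_on_compose2[OF w' _ subset_UNIV]
  have contw: "continuous_on S w" for S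
    by (rule DERIV_continuous_on) (rule has_field_derivative_at_within[OF w])
  have parts: "integral {a..b} (\<lambda>\<theta>. y (t + \<theta>) * w \<theta>) =
      Y (t + b) * w b - Y (t + a) * w a - integral {a..b} (\<lambda>\<theta>. Y (t + \<theta>) * w' \<theta>)" for t
  proof -
    have "((\<lambda>\<theta>. Y (t + \<theta>) * w' \<theta>) has_integral integral {a..b} (\<lambda>\<theta>. Y (t + \<theta>) * w' \<theta>)) {a..b}"
      by (intro integrable_integral integrable_continuous_interval continuous_intros)
    then have "((\<lambda>\<theta>. y (t + \<theta>) * w \<theta>) has_integral
      (Y (t + b) * w b - Y (t + a) * w a - integral {a..b} (\<lambda>\<theta>. Y (t + \<theta>) * w' \<theta>))) {a..b}"
      by (intro integration_by_parts[OF bounded_bilinear_mult ab, where f = "\<lambda>\<theta>. Y (t + \<theta>)"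
            and g = w and g' = w'] continuous_intros contw)
         (auto simp: has_real_derivative_iff_has_vector_derivative[symmetric] w Y2)
    then show ?thesis by (rule integral_unique)
  qed
  have leib: "((\<lambda>t. integral (cbox a b) (\<lambda>\<theta>. Y (t + \<theta>) * w' \<theta>)) has_real_derivative
      integral (cbox a b) (\<lambda>\<theta>. y (t + \<theta>) * w' \<theta>)) (at t within UNIV)"
  proof (rule leibniz_rule_field_derivative)
    show "((\<lambda>t. Y (t + \<theta>) * w' \<theta>) has_real_derivative y (t + \<theta>) * w' \<theta>) (at t within UNIV)" for t \<theta>
      by (rule derivative_eq_intros Y1 refl | simp)+
    show "(\<lambda>\<theta>. Y (t + \<theta>) * w' \<theta>) integrable_on cbox a b" for t
      by (intro integrable_continuous continuous_intros)
    show "continuous_on (UNIV \<times> cbox a b) (\<lambda>(t, \<theta>). y (t + \<theta>) * w' \<theta>)"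
      unfolding split_beta by (intro continuous_intros)
  qed auto
  show ?thesis
    unfolding parts using leib
    by (auto intro!: derivative_eq_intros Y1)
qed

section \<open>Integrals of separated kernels along a trajectory\<close>

lemma polynomial_has_derivative:
  fixes q :: "'a::euclidean_space \<Rightarrow> real"
  assumes "real_polynomial_function q"
  shows "(q has_derivative frechet_derivative q (at a)) (at a)"
  using assms differentiable_at_real_polynomial_function frechet_derivative_works by blast

lemma continuous_on_polynomial_compose:
  fixes q :: "'a::euclidean_space \<Rightarrow> real"
  assumes "real_polynomial_function q" "continuous_on S \<psi>"
  shows "continuous_on S (\<lambda>s. q (\<psi> s))"
  by (rule continuous_on_compose2[OF _ assms(2) subset_UNIV])
     (simp add: continuous_on_eq_continuous_at continuous_real_polymonial_function assms(1))

lemma integral_sum_mult: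
  fixes w :: "'m \<Rightarrow> real \<Rightarrow> real"
  assumes "finite S" "\<And>m. m \<in> S \<Longrightarrow> continuous_on {a..b} (w m)"
  shows "integral {a..b} (\<lambda>\<theta>. \<Sum>m\<in>S. u m * w m \<theta>) = (\<Sum>m\<in>S. u m * integral {a..b} (w m))"
  using assms by (subst integral_sum) (auto intro!: integrable_continuous_interval continuous_intros)

lemma integral_sum_mult2:
  fixes w w' :: "'m \<Rightarrow> real \<Rightarrow> real"
  assumes "finite S" "\<And>m. m \<in> S \<Longrightarrow> continuous_on {a..b} (w m)"
    "\<And>m. m \<in> S \<Longrightarrow> continuous_on {a'..b'} (w' m)"
  shows "integral {a..b} (\<lambda>\<theta>. integral {a'..b'} (\<lambda>\<omega>. \<Sum>m\<in>S. u m * (w m \<theta> * w' m \<omega>))) =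
    (\<Sum>m\<in>S. u m * (integral {a..b} (w m) * integral {a'..b'} (w' m)))"
proof -
  have "integral {a'..b'} (\<lambda>\<omega>. \<Sum>m\<in>S. u m * (w m \<theta> * w' m \<omega>)) =
      (\<Sum>m\<in>S. (u m * integral {a'..b'} (w' m)) * w m \<theta>)" for \<theta>
    using integral_sum_mult[OF assms(1,3), where u = "\<lambda>m. u m * w m \<theta>"] by (simp add: mult_ac)
  then show ?thesis
    using integral_sum_mult[OF assms(1,2), where u = "\<lambda>m. u m * integral {a'..b'} (w' m)"]
    by (simp add: mult_ac)
qed

text \<open>Existence of the gradient: on \<open>\<real>\<^sup>n\<close> every bounded linear functional is an inner product.\<close>

lemma grad_inner:
  fixes F :: "real ^ 'n \<Rightarrow> real"
  assumes "(F has_derivative F') (at a)"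
  shows "grad F a \<bullet> v = F' v"
proof -
  interpret bounded_linear F' by (rule has_derivative_bounded_linear[OF assms])
  define D where "D = (\<Sum>b\<in>Basis. F' b *\<^sub>R b)"
  have D: "h \<bullet> D = F' h" for h
  proof -
    have "F' h = F' (\<Sum>b\<in>Basis. (h \<bullet> b) *\<^sub>R b)" by (simp add: euclidean_representation)
    also have "\<dots> = h \<bullet> D" by (simp add: sum scaleR D_def inner_sum_right mult.commute)
    finally show ?thesis by simp
  qed
  have "grad F a = D"
    unfolding grad_def gderiv_def
  proof (rule the_equality)
    show "(F has_derivative (\<lambda>h. h \<bullet> D)) (at a)" using assms by (simp add: D)
    fix D' assume "(F has_derivative (\<lambda>h. h \<bullet> D')) (at a)"
    then have "(\<lambda>h. h \<bullet> D') = F'" using assms by (rule has_derivative_unique)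
    then have "h \<bullet> D' = h \<bullet> D" for h by (simp add: D fun_eq_iff)
    then show "D' = D" by (metis inner_commute vector_eq_rdot)
  qed
  then show ?thesis using D[of v] by (simp add: inner_commute)
qed

text \<open>Separation of variables in a kernel \<open>F\<close> of two states and two times.  It reduces integrals of \<open>F\<close>
  along a history to the moments of that history.\<close>

locale separated =
  fixes F :: "real ^ 'n::finite \<Rightarrow> real ^ 'n \<Rightarrow> real \<Rightarrow> real \<Rightarrow> real"
    and S :: "'m set" and c :: "'m \<Rightarrow> real" and A B :: "'m \<Rightarrow> real ^ 'n \<Rightarrow> real" and k l :: "'m \<Rightarrow> nat"
  assumes F: "F a b \<theta> \<omega> = (\<Sum>m\<in>S. c m * (A m a * B m b * \<theta> ^ k m * \<omega> ^ l m))"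
    and fin: "finite S"
    and A: "\<And>m. real_polynomial_function (A m)" and B: "\<And>m. real_polynomial_function (B m)"
begin

lemmas continuous_AB = continuous_on_polynomial_compose[OF A] continuous_on_polynomial_compose[OF B]

lemma deriv_fst:
  "deriv (\<lambda>s. F a b s \<omega>) \<theta> = (\<Sum>m\<in>S. c m * (A m a * B m b * (real (k m) * \<theta> ^ (k m - 1)) * \<omega> ^ l m))"
  by (rule DERIV_imp_deriv) (auto simp: F intro!: derivative_eq_intros sum.cong)

lemma deriv_snd:
  "deriv (\<lambda>s. F a b \<theta> s) \<omega> = (\<Sum>m\<in>S. c m * (A m a * B m b * \<theta> ^ k m * (real (l m) * \<omega> ^ (l m - 1))))"
  by (rule DERIV_imp_deriv) (auto simp: F intro!: derivative_eq_intros sum.cong)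

lemma grad_fst:
  "grad (\<lambda>z. F z b \<theta> \<omega>) a \<bullet> v =
     (\<Sum>m\<in>S. c m * (frechet_derivative (A m) (at a) v * B m b * \<theta> ^ k m * \<omega> ^ l m))"
  by (rule grad_inner)
     (auto simp: F intro!: derivative_eq_intros polynomial_has_derivative A sum.cong)

lemma continuous_F:
  assumes "continuous_on T \<phi>" "continuous_on T \<psi>" "continuous_on T u" "continuous_on T w"
  shows "continuous_on T (\<lambda>s. F (\<phi> s) (\<psi> s) (u s) (w s))"
  unfolding F by (intro continuous_intros continuous_AB assms)

lemma continuous_single_integrand:
  assumes "continuous_on T \<psi>"
  shows "continuous_on T (\<lambda>\<theta>. grad (\<lambda>z. F z (\<psi> \<theta>) \<theta> \<omega>) a \<bullet> v)"
    "continuous_on T (\<lambda>\<theta>. deriv (\<lambda>s. F a (\<psi> \<theta>) s \<omega>) \<theta>)"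
  unfolding grad_fst deriv_fst
  by (intro continuous_intros continuous_AB assms)+

lemma single_integral:
  assumes "continuous_on {a..b} \<psi>"
  shows "integral {a..b} (\<lambda>\<theta>. F z (\<psi> \<theta>) \<theta> \<omega>) =
    (\<Sum>m\<in>S. (c m * \<omega> ^ l m) * (A m z * integral {a..b} (\<lambda>\<theta>. B m (\<psi> \<theta>) * \<theta> ^ k m)))"
  unfolding mult.assoc[symmetric, of _ "A _ z"]
  by (subst integral_sum_mult[symmetric])
     (auto simp: F mult_ac intro!: fin continuous_intros continuous_AB assms)

lemma double_integral:
  assumes "continuous_on {a..b} \<psi>" "continuous_on {a'..b'} \<psi>"
  shows "integral {a..b} (\<lambda>\<theta>. integral {a'..b'} (\<lambda>\<omega>. F (\<psi> \<theta>) (\<psi> \<omega>) \<theta> \<omega>)) =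
    (\<Sum>m\<in>S. c m * (integral {a..b} (\<lambda>\<theta>. A m (\<psi> \<theta>) * \<theta> ^ k m) *
       integral {a'..b'} (\<lambda>\<omega>. B m (\<psi> \<omega>) * \<omega> ^ l m)))"
  by (subst integral_sum_mult2[symmetric])
     (auto simp: F mult_ac intro!: fin continuous_intros continuous_AB assms)

context
  fixes y :: "real \<Rightarrow> real ^ 'n"
  assumes y: "continuous_on UNIV y"
begin

lemma shift_continuous: "continuous_on T (\<lambda>\<theta>. y (t + \<theta>))"
  by (rule continuous_on_compose2[OF y _ subset_UNIV]) (intro continuous_intros)

lemma has_real_derivative_moment:
  assumes q: "real_polynomial_function q" and ab: "a \<le> b"
  shows "((\<lambda>t. integral {a..b} (\<lambda>\<theta>. q (y (t + \<theta>)) * \<theta> ^ j)) has_real_derivative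
     q (y (t + b)) * b ^ j - q (y (t + a)) * a ^ j
       - integral {a..b} (\<lambda>\<theta>. q (y (t + \<theta>)) * (real j * \<theta> ^ (j - 1)))) (at t)"
  by (rule has_real_derivative_window_integral[OF continuous_on_polynomial_compose[OF q y] _ _ ab])
     (auto intro!: derivative_eq_intros continuous_intros)

text \<open>The derivative of the shift \<open>t \<mapsto> y (t + \<theta>)\<close> has been moved onto the explicit dependence on \<open>\<theta>\<close> by
  integration by parts, which explains the boundary terms and the minus sign.\<close>

lemma single_integral_has_derivative:
  assumes ab: "a \<le> b" and y': "(y has_vector_derivative v) (at t within T)"
  shows "((\<lambda>t. integral {a..b} (\<lambda>\<theta>. F (y t) (y (t + \<theta>)) \<theta> \<omega>)) has_real_derivative
     F (y t) (y (t + b)) b \<omega> - F (y t) (y (t + a)) a \<omega>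
       + integral {a..b} (\<lambda>\<theta>. grad (\<lambda>z. F z (y (t + \<theta>)) \<theta> \<omega>) (y t) \<bullet> v
           - deriv (\<lambda>s. F (y t) (y (t + \<theta>)) s \<omega>) \<theta>)) (at t within T)"
proof -
  let ?d = "\<lambda>m. frechet_derivative (A m) (at (y t)) v"
  let ?W = "\<lambda>m t. integral {a..b} (\<lambda>\<theta>. B m (y (t + \<theta>)) * \<theta> ^ k m)"
  let ?W' = "\<lambda>m. integral {a..b} (\<lambda>\<theta>. B m (y (t + \<theta>)) * (real (k m) * \<theta> ^ (k m - 1)))"
  have dA: "((\<lambda>t. A m (y t)) has_real_derivative ?d m) (at t within T)" for m
  proof -
    have lin: "bounded_linear (frechet_derivative (A m) (at (y t)))"
      using polynomial_has_derivative[OF A] by (rule has_derivative_bounded_linear)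
    show ?thesis
      using has_derivative_compose[OF y'[unfolded has_vector_derivative_def] polynomial_has_derivative[OF A[of m]]]
      by (simp add: has_field_derivative_def linear_simps[OF lin] mult_commute_abs)
  qed
  have "((\<lambda>t. \<Sum>m\<in>S. (c m * \<omega> ^ l m) * (A m (y t) * ?W m t)) has_real_derivative
      (\<Sum>m\<in>S. (c m * \<omega> ^ l m) * (?d m * ?W m t +
         (B m (y (t + b)) * b ^ k m - B m (y (t + a)) * a ^ k m - ?W' m) * A m (y t)))) (at t within T)"
    by (intro DERIV_sum DERIV_cmult DERIV_mult dA
        has_field_derivative_at_within[OF has_real_derivative_moment[OF B ab]])
  moreover have "integral {a..b} (\<lambda>\<theta>. grad (\<lambda>z. F z (y (t + \<theta>)) \<theta> \<omega>) (y t) \<bullet> v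
           - deriv (\<lambda>s. F (y t) (y (t + \<theta>)) s \<omega>) \<theta>)
      = (\<Sum>m\<in>S. (c m * \<omega> ^ l m) * (?d m * ?W m t)) - (\<Sum>m\<in>S. (c m * \<omega> ^ l m) * (A m (y t) * ?W' m))"
  proof -
    have "integral {a..b} (\<lambda>\<theta>. grad (\<lambda>z. F z (y (t + \<theta>)) \<theta> \<omega>) (y t) \<bullet> v)
        = (\<Sum>m\<in>S. (c m * \<omega> ^ l m * ?d m) * ?W m t)"
      unfolding grad_fst
      by (subst integral_sum_mult[symmetric])
         (auto simp: mult_ac intro!: fin continuous_intros continuous_AB shift_continuous)
    moreover have "integral {a..b} (\<lambda>\<theta>. deriv (\<lambda>s. F (y t) (y (t + \<theta>)) s \<omega>) \<theta>)
        = (\<Sum>m\<in>S. (c m * \<omega> ^ l m * A m (y t)) * ?W' m)"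
      unfolding deriv_fst
      by (subst integral_sum_mult[symmetric])
         (auto simp: mult_ac intro!: fin continuous_intros continuous_AB shift_continuous)
    ultimately show ?thesis
      by (subst integral_diff)
         (auto simp: mult_ac intro!: integrable_continuous_interval continuous_single_integrand shift_continuous)
  qed
  ultimately show ?thesis
    unfolding single_integral[OF shift_continuous]
    by (elim DERIV_cong) (simp add: F sum_subtractf[symmetric] sum.distrib[symmetric] algebra_simps)
qed

lemma double_integral_has_derivative:
  assumes ab: "a \<le> b" and ab': "a' \<le> b'"
  shows "((\<lambda>t. integral {a..b} (\<lambda>\<theta>. integral {a'..b'} (\<lambda>\<omega>. F (y (t + \<theta>)) (y (t + \<omega>)) \<theta> \<omega>))) has_real_derivative
      integral {a'..b'} (\<lambda>\<omega>. F (y (t + b)) (y (t + \<omega>)) b \<omega> - F (y (t + a)) (y (t + \<omega>)) a \<omega>)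
      + integral {a..b} (\<lambda>\<theta>. F (y (t + \<theta>)) (y (t + b')) \<theta> b' - F (y (t + \<theta>)) (y (t + a')) \<theta> a')
      - integral {a..b} (\<lambda>\<theta>. integral {a'..b'} (\<lambda>\<omega>.
          deriv (\<lambda>s. F (y (t + \<theta>)) (y (t + \<omega>)) s \<omega>) \<theta> + deriv (\<lambda>s. F (y (t + \<theta>)) (y (t + \<omega>)) \<theta> s) \<omega>))) (at t)"
proof -
  let ?P = "\<lambda>m t. integral {a..b} (\<lambda>\<theta>. A m (y (t + \<theta>)) * \<theta> ^ k m)"
  let ?P' = "\<lambda>m. integral {a..b} (\<lambda>\<theta>. A m (y (t + \<theta>)) * (real (k m) * \<theta> ^ (k m - 1)))"
  let ?R = "\<lambda>m t. integral {a'..b'} (\<lambda>\<omega>. B m (y (t + \<omega>)) * \<omega> ^ l m)"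
  let ?R' = "\<lambda>m. integral {a'..b'} (\<lambda>\<omega>. B m (y (t + \<omega>)) * (real (l m) * \<omega> ^ (l m - 1)))"
  note cont = fin continuous_intros continuous_AB shift_continuous
    shift_continuous[of _ t, unfolded add.commute[of t]]
  have "((\<lambda>t. \<Sum>m\<in>S. c m * (?P m t * ?R m t)) has_real_derivative
      (\<Sum>m\<in>S. c m * ((A m (y (t + b)) * b ^ k m - A m (y (t + a)) * a ^ k m - ?P' m) * ?R m t +
         (B m (y (t + b')) * b' ^ l m - B m (y (t + a')) * a' ^ l m - ?R' m) * ?P m t))) (at t)"
    by (intro DERIV_sum DERIV_cmult DERIV_mult
        has_real_derivative_moment[OF A ab] has_real_derivative_moment[OF B ab'])
  moreover have "integral {a'..b'} (\<lambda>\<omega>. F (y (t + b)) (y (t + \<omega>)) b \<omega> - F (y (t + a)) (y (t + \<omega>)) a \<omega>)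
      = (\<Sum>m\<in>S. (c m * (A m (y (t + b)) * b ^ k m - A m (y (t + a)) * a ^ k m)) * ?R m t)"
    by (subst integral_sum_mult[symmetric])
       (auto simp: F sum_subtractf[symmetric] algebra_simps intro!: cont)
  moreover have "integral {a..b} (\<lambda>\<theta>. F (y (t + \<theta>)) (y (t + b')) \<theta> b' - F (y (t + \<theta>)) (y (t + a')) \<theta> a')
      = (\<Sum>m\<in>S. (c m * (B m (y (t + b')) * b' ^ l m - B m (y (t + a')) * a' ^ l m)) * ?P m t)"
    by (subst integral_sum_mult[symmetric])
       (auto simp: F sum_subtractf[symmetric] algebra_simps intro!: cont)
  moreover have "integral {a..b} (\<lambda>\<theta>. integral {a'..b'} (\<lambda>\<omega>.
          deriv (\<lambda>s. F (y (t + \<theta>)) (y (t + \<omega>)) s \<omega>) \<theta> + deriv (\<lambda>s. F (y (t + \<theta>)) (y (t + \<omega>)) \<theta> s) \<omega>))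
      = (\<Sum>m\<in>S. c m * (?P' m * ?R m t)) + (\<Sum>m\<in>S. c m * (?P m t * ?R' m))"
  proof -
    have "integral {a'..b'} (\<lambda>\<omega>.
          deriv (\<lambda>s. F (y (t + \<theta>)) (y (t + \<omega>)) s \<omega>) \<theta> + deriv (\<lambda>s. F (y (t + \<theta>)) (y (t + \<omega>)) \<theta> s) \<omega>)
       = (\<Sum>m\<in>S. (c m * ?R m t) * (A m (y (t + \<theta>)) * (real (k m) * \<theta> ^ (k m - 1))))
         + (\<Sum>m\<in>S. (c m * ?R' m) * (A m (y (t + \<theta>)) * \<theta> ^ k m))" for \<theta>
    proof -
      have "integral {a'..b'} (\<lambda>\<omega>. deriv (\<lambda>s. F (y (t + \<theta>)) (y (t + \<omega>)) s \<omega>) \<theta>)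
         = (\<Sum>m\<in>S. (c m * (A m (y (t + \<theta>)) * (real (k m) * \<theta> ^ (k m - 1)))) * ?R m t)"
        unfolding deriv_fst by (subst integral_sum_mult[symmetric]) (auto simp: mult_ac intro!: cont)
      moreover have "integral {a'..b'} (\<lambda>\<omega>. deriv (\<lambda>s. F (y (t + \<theta>)) (y (t + \<omega>)) \<theta> s) \<omega>)
         = (\<Sum>m\<in>S. (c m * (A m (y (t + \<theta>)) * \<theta> ^ k m)) * ?R' m)"
        unfolding deriv_snd by (subst integral_sum_mult[symmetric]) (auto simp: mult_ac intro!: cont)
      ultimately show ?thesis
        by (subst integral_add)
           (auto simp: mult_ac deriv_fst deriv_snd intro!: integrable_continuous_interval cont)
    qed
    moreover have "integral {a..b} (\<lambda>\<theta>. 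
         (\<Sum>m\<in>S. (c m * ?R m t) * (A m (y (t + \<theta>)) * (real (k m) * \<theta> ^ (k m - 1))))
         + (\<Sum>m\<in>S. (c m * ?R' m) * (A m (y (t + \<theta>)) * \<theta> ^ k m))) =
         (\<Sum>m\<in>S. (c m * ?R m t) * ?P' m) + (\<Sum>m\<in>S. (c m * ?R' m) * ?P m t)"
      by (subst integral_add)
         (auto intro!: integrable_continuous_interval integral_sum_mult cont arg_cong2[where f = "(+)"])
    ultimately show ?thesis by (simp add: mult_ac)
  qed
  ultimately show ?thesis
    unfolding double_integral[OF shift_continuous shift_continuous]
    by (elim DERIV_cong) (simp add: sum_subtractf[symmetric] sum.distrib[symmetric] algebra_simps)
qed

end

text \<open>Continuity of the functional at the zero history, in the form used for sequences of histories.\<close>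

lemma moment_tendsto:
  fixes \<psi> :: "nat \<Rightarrow> real \<Rightarrow> real ^ 'n"
  assumes q: "real_polynomial_function q" and cont: "\<And>n. continuous_on {a..b} (\<psi> n)"
    and lim: "uniform_limit {a..b} \<psi> (\<lambda>_. 0) sequentially"
  shows "(\<lambda>n. integral {a..b} (\<lambda>\<theta>. q (\<psi> n \<theta>) * \<theta> ^ j)) \<longlonglongrightarrow> q 0 * integral {a..b} (\<lambda>\<theta>. \<theta> ^ j)"
proof -
  have "uniform_limit {a..b} (\<lambda>n \<theta>. q (\<psi> n \<theta>)) (\<lambda>_. q 0) sequentially"
  proof (rule uniform_limitI)
    fix e :: real assume "e > 0"
    then obtain d where d: "d > 0" "\<And>z. dist z 0 < d \<Longrightarrow> dist (q z) (q 0) < e"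
      using continuous_real_polymonial_function[OF q, of 0] unfolding continuous_at_eps_delta by metis
    show "\<forall>\<^sub>F n in sequentially. \<forall>\<theta>\<in>{a..b}. dist (q (\<psi> n \<theta>)) (q 0) < e"
      using uniform_limitD[OF lim d(1)] by eventually_elim (use d(2) in auto)
  qed
  then have "uniform_limit {a..b} (\<lambda>n \<theta>. q (\<psi> n \<theta>) * \<theta> ^ j) (\<lambda>\<theta>. q 0 * \<theta> ^ j) sequentially"
    by (rule uniform_lim_mult[OF _ uniform_limit_const])
       (auto intro!: compact_imp_bounded compact_continuous_image continuous_intros)
  then obtain I J where IJ: "\<And>n. ((\<lambda>\<theta>. q (\<psi> n \<theta>) * \<theta> ^ j) has_integral I n) {a..b}"
     "((\<lambda>\<theta>. q 0 * \<theta> ^ j) has_integral J) {a..b}" "I \<longlonglongrightarrow> J"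
    by (rule uniform_limit_integral)
       (auto intro!: continuous_intros continuous_on_polynomial_compose[OF q] cont)
  show ?thesis
    using integral_unique[OF IJ(1)] integral_unique[OF IJ(2)] IJ(3) by simp
qed

lemma single_integral_tendsto:
  fixes \<psi> :: "nat \<Rightarrow> real \<Rightarrow> real ^ 'n"
  assumes cont: "\<And>n. continuous_on {a..b} (\<psi> n)"
    and lim: "uniform_limit {a..b} \<psi> (\<lambda>_. 0) sequentially" and z: "z \<longlonglongrightarrow> 0"
  shows "(\<lambda>n. integral {a..b} (\<lambda>\<theta>. F (z n) (\<psi> n \<theta>) \<theta> \<omega>)) \<longlonglongrightarrow> integral {a..b} (\<lambda>\<theta>. F 0 0 \<theta> \<omega>)"
proof -
  have zA: "(\<lambda>n. A m (z n)) \<longlonglongrightarrow> A m 0" for m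
    using continuous_real_polymonial_function[OF A] z by (rule isCont_tendsto_compose)
  show ?thesis
    using single_integral[of a b "\<lambda>_. 0" 0 \<omega>]
    by (simp add: single_integral[OF cont] continuous_on_const)
       (intro tendsto_intros zA moment_tendsto B cont lim)
qed

lemma double_integral_tendsto:
  fixes \<psi> :: "nat \<Rightarrow> real \<Rightarrow> real ^ 'n"
  assumes cont: "\<And>n. continuous_on {a..b} (\<psi> n)" "\<And>n. continuous_on {a'..b'} (\<psi> n)"
    and lim: "uniform_limit {a..b} \<psi> (\<lambda>_. 0) sequentially" "uniform_limit {a'..b'} \<psi> (\<lambda>_. 0) sequentially"
  shows "(\<lambda>n. integral {a..b} (\<lambda>\<theta>. integral {a'..b'} (\<lambda>\<omega>. F (\<psi> n \<theta>) (\<psi> n \<omega>) \<theta> \<omega>)))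
     \<longlonglongrightarrow> integral {a..b} (\<lambda>\<theta>. integral {a'..b'} (\<lambda>\<omega>. F 0 0 \<theta> \<omega>))"
  using double_integral[of a b "\<lambda>_. 0" a' b']
  by (simp add: double_integral[OF cont] continuous_on_const)
     (intro tendsto_intros moment_tendsto A B cont lim)

end

lemma separated_eval2:
  "separated (\<lambda>a b \<theta> \<omega>. eval2 p (two_args a b) \<theta> \<omega>) (Poly_Mapping.keys p) (Poly_Mapping.lookup p)
     monom_fst monom_snd (\<lambda>m. Poly_Mapping.lookup m Theta) (\<lambda>m. Poly_Mapping.lookup m Omega)"
  by unfold_locales
     (auto simp: eval2_two_args_separated real_polynomial_function_monom_fst real_polynomial_function_monom_snd)

section \<open>Positivity of the two parts of the functional\<close>

lemma finite_exponents: "finite (exponents m :: ('n::finite \<Rightarrow> nat) set)"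
proof (rule finite_subset)
  have "e c \<le> m" if "(\<Sum>c\<in>UNIV. e c) \<le> m" for e :: "'n \<Rightarrow> nat" and c
    using member_le_sum[of c UNIV e] that by simp
  then show "exponents m \<subseteq> (UNIV :: 'n set) \<rightarrow>\<^sub>E {..m}"
    by (auto simp: exponents_def)
  show "finite ((UNIV :: 'n set) \<rightarrow>\<^sub>E {..m})"
    by (rule finite_PiE) auto
qed

lemma R_hat_entry:
  assumes "p \<in> {1..K} \<times> exponents m" "p' \<in> {1..K} \<times> exponents m"
  shows "R_hat K m Q \<theta> \<omega> p p' = (\<Sum>k\<in>{0..m}. \<Sum>l\<in>{0..m}. \<theta> ^ k * Q (p, k) (p', l) * \<omega> ^ l)"
proof -
  have pick: "(\<Sum>u\<in>Q_index K m. Z_bar s u r * G u) = (\<Sum>k\<in>{0..m}. s ^ k * G (r, k))"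
    if r: "r \<in> {1..K} \<times> exponents m" for s r and G :: "(nat \<times> ('n::finite \<Rightarrow> nat)) \<times> nat \<Rightarrow> real"
  proof -
    have "(\<Sum>u\<in>Q_index K m. Z_bar s u r * G u) = (\<Sum>u\<in>Pair r ` {0..m}. Z_bar s u r * G u)"
      using r by (intro sum.mono_neutral_right) (auto simp: Q_index_def Z_bar_def finite_exponents)
    also have "\<dots> = (\<Sum>k\<in>{0..m}. Z_bar s (r, k) r * G (r, k))"
      by (subst sum.reindex) (auto simp: inj_on_def)
    finally show ?thesis by (simp add: Z_bar_def)
  qed
  have "R_hat K m Q \<theta> \<omega> p p' = (\<Sum>u\<in>Q_index K m. \<Sum>v\<in>Q_index K m. Z_bar \<theta> u p * (Z_bar \<omega> v p' * Q u v))"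
    unfolding R_hat_def by (intro sum.cong refl) (simp only: mult_ac)
  also have "\<dots> = (\<Sum>k\<in>{0..m}. \<Sum>l\<in>{0..m}. \<theta> ^ k * (\<omega> ^ l * Q (p, k) (p', l)))"
    unfolding sum_distrib_left[symmetric] pick[OF assms(1)] pick[OF assms(2)] ..
  finally show ?thesis by (simp only: mult_ac)
qed

text \<open>The double integrals add up to \<open>z\<^sup>T Q\<^sub>0 z\<close>, where \<open>z\<close> is the vector of the moments of \<open>\<psi>\<close> against the
  monomials in \<open>\<psi> \<theta>\<close> and in the rescaled time on the respective delay interval.\<close>

lemma Xi2_double_integral_nonneg:
  fixes h :: "nat \<Rightarrow> nat \<Rightarrow> 'n::finite indet rpoly"
  assumes h: "h \<in> Xi2 K \<tau> d"
    and cont: "\<And>i. i \<in> {1..K} \<Longrightarrow> continuous_on (delay_interval \<tau> i) \<psi>"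
  shows "(\<Sum>i=1..K. \<Sum>j=1..K. integral (delay_interval \<tau> i) (\<lambda>\<theta>. integral (delay_interval \<tau> j)
     (\<lambda>\<omega>. eval2 (h i j) (two_args (\<psi> \<theta>) (\<psi> \<omega>)) \<theta> \<omega>))) \<ge> 0"
proof -
  obtain m Q where psd: "psd_on (Q_index K m) Q"
    and h_eq: "\<And>i j x1 x2 \<theta> \<omega>. i \<in> {1..K} \<Longrightarrow> j \<in> {1..K} \<Longrightarrow>
       eval2 (h i j) (two_args x1 x2) \<theta> \<omega> = (\<Sum>e\<in>exponents m. \<Sum>e'\<in>exponents m.
              Z_vec x1 e * R_hat K m Q (rescale K \<tau> i \<theta>) (rescale K \<tau> j \<omega>) (i, e) (j, e') * Z_vec x2 e')"
    using h unfolding Xi2_def by blast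
  define U where "U = (exponents m :: ('n \<Rightarrow> nat) set) \<times> {0..m}"
  have finU: "finite U" by (simp add: U_def finite_exponents)
  define w where "w i u \<theta> = Z_vec (\<psi> \<theta>) (fst u) * rescale K \<tau> i \<theta> ^ snd u" for i \<theta> and u :: "('n \<Rightarrow> nat) \<times> nat"
  define z where "z u = integral (delay_interval \<tau> (fst (fst u))) (w (fst (fst u)) (snd (fst u), snd u))"
    for u :: "(nat \<times> ('n \<Rightarrow> nat)) \<times> nat"
  have contw: "continuous_on (delay_interval \<tau> i) (w i u)" if "i \<in> {1..K}" for i u
    unfolding w_def Z_vec_def rescale_def by (intro continuous_intros cont that)
  have inner: "integral (delay_interval \<tau> i) (\<lambda>\<theta>. integral (delay_interval \<tau> j)
       (\<lambda>\<omega>. eval2 (h i j) (two_args (\<psi> \<theta>) (\<psi> \<omega>)) \<theta> \<omega>)) =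
      (\<Sum>u\<in>U. \<Sum>v\<in>U. z ((i, fst u), snd u) * Q ((i, fst u), snd u) ((j, fst v), snd v) * z ((j, fst v), snd v))"
    if ij: "i \<in> {1..K}" "j \<in> {1..K}" for i j
  proof -
    have "eval2 (h i j) (two_args (\<psi> \<theta>) (\<psi> \<omega>)) \<theta> \<omega> =
        (\<Sum>uv\<in>U \<times> U. Q ((i, fst (fst uv)), snd (fst uv)) ((j, fst (snd uv)), snd (snd uv))
          * (w i (fst uv) \<theta> * w j (snd uv) \<omega>))" for \<theta> \<omega>
    proof -
      have "eval2 (h i j) (two_args (\<psi> \<theta>) (\<psi> \<omega>)) \<theta> \<omega> =
        (\<Sum>e\<in>exponents m. \<Sum>e'\<in>exponents m. \<Sum>k\<in>{0..m}. \<Sum>l\<in>{0..m}.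
            Q ((i, e), k) ((j, e'), l) * (w i (e, k) \<theta> * w j (e', l) \<omega>))"
        unfolding h_eq[OF ij]
      proof (intro sum.cong refl)
        fix e e' :: "'n \<Rightarrow> nat" assume "e \<in> exponents m" "e' \<in> exponents m"
        then have "R_hat K m Q s s' (i, e) (j, e') =
            (\<Sum>k\<in>{0..m}. \<Sum>l\<in>{0..m}. s ^ k * Q ((i, e), k) ((j, e'), l) * s' ^ l)" for s s'
          using ij by (intro R_hat_entry) auto
        then show "Z_vec (\<psi> \<theta>) e * R_hat K m Q (rescale K \<tau> i \<theta>) (rescale K \<tau> j \<omega>) (i, e) (j, e') * Z_vec (\<psi> \<omega>) e' =
          (\<Sum>k\<in>{0..m}. \<Sum>l\<in>{0..m}. Q ((i, e), k) ((j, e'), l) * (w i (e, k) \<theta> * w j (e', l) \<omega>))"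
          by (simp add: w_def sum_distrib_left sum_distrib_right mult_ac)
      qed
      also have "\<dots> = (\<Sum>e\<in>exponents m. \<Sum>k\<in>{0..m}. \<Sum>e'\<in>exponents m. \<Sum>l\<in>{0..m}.
            Q ((i, e), k) ((j, e'), l) * (w i (e, k) \<theta> * w j (e', l) \<omega>))"
        by (intro sum.cong refl sum.swap)
      also have "\<dots> = (\<Sum>u\<in>U. \<Sum>v\<in>U. Q ((i, fst u), snd u) ((j, fst v), snd v)
          * (w i u \<theta> * w j v \<omega>))"
        unfolding U_def by (simp add: sum.cartesian_product')
      finally show ?thesis by (simp add: sum.cartesian_product')
    qed
    then have "integral (delay_interval \<tau> i) (\<lambda>\<theta>. integral (delay_interval \<tau> j)
       (\<lambda>\<omega>. eval2 (h i j) (two_args (\<psi> \<theta>) (\<psi> \<omega>)) \<theta> \<omega>)) =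
      (\<Sum>uv\<in>U \<times> U. Q ((i, fst (fst uv)), snd (fst uv)) ((j, fst (snd uv)), snd (snd uv))
          * (integral (delay_interval \<tau> i) (w i (fst uv)) * integral (delay_interval \<tau> j) (w j (snd uv))))"
      using contw ij finU unfolding delay_interval_def
      by (simp add: integral_sum_mult2)
    then show ?thesis
      by (simp add: sum.cartesian_product' z_def mult_ac)
  qed
  have "0 \<le> (\<Sum>u\<in>Q_index K m. \<Sum>v\<in>Q_index K m. z u * Q u v * z v)"
    using psd unfolding psd_on_def by blast
  also have "\<dots> = (\<Sum>i=1..K. \<Sum>u\<in>U. \<Sum>j=1..K. \<Sum>v\<in>U.
      z ((i, fst u), snd u) * Q ((i, fst u), snd u) ((j, fst v), snd v) * z ((j, fst v), snd v))"
  proof -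
    have *: "(\<Sum>u\<in>Q_index K m. G u) = (\<Sum>i=1..K. \<Sum>u\<in>U. G ((i, fst u), snd u))"
      for G :: "(nat \<times> ('n \<Rightarrow> nat)) \<times> nat \<Rightarrow> real"
      unfolding Q_index_def U_def by (simp add: sum.cartesian_product')
    show ?thesis by (simp add: *)
  qed
  also have "\<dots> = (\<Sum>i=1..K. \<Sum>j=1..K. \<Sum>u\<in>U. \<Sum>v\<in>U.
      z ((i, fst u), snd u) * Q ((i, fst u), snd u) ((j, fst v), snd v) * z ((j, fst v), snd v))"
    by (intro sum.cong refl sum.swap)
  also have "\<dots> = (\<Sum>i=1..K. \<Sum>j=1..K. integral (delay_interval \<tau> i) (\<lambda>\<theta>. integral (delay_interval \<tau> j)
     (\<lambda>\<omega>. eval2 (h i j) (two_args (\<psi> \<theta>) (\<psi> \<omega>)) \<theta> \<omega>)))"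
    by (intro sum.cong refl inner[symmetric]) auto
  finally show ?thesis .
qed

lemma continuous_eval1: "continuous_on S (\<lambda>\<theta>. eval1 p x \<theta>)"
proof -
  have "continuous_on S (\<lambda>\<theta>. indet_val x \<theta> 0 v)" for v
    by (cases v) (auto intro!: continuous_intros)
  then show ?thesis
    unfolding eval2_def rpoly_eval_def by (intro continuous_intros)
qed

text \<open>The points \<open>X \<theta>\<close> may vary with \<open>\<theta>\<close> only in the last vector variable.  Hence the \<open>t\<^sub>i\<close> are evaluated at a
  fixed point and cancel after integration, although they have no sign pointwise.\<close>

lemma Xi_gen_integral_lower:
  fixes q :: "nat \<Rightarrow> 'n::finite indet rpoly"
  assumes q: "q \<in> Xi_gen l K \<tau> d" and l: "1 \<le> l"
    and \<tau>0: "\<tau> 0 = 0" and mono: "\<And>i. i \<in> {1..K} \<Longrightarrow> \<tau> (i - 1) \<le> \<tau> i"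
  obtains \<alpha> where "\<alpha> > 0"
    "\<And>x X. (\<And>\<theta> k. 1 \<le> k \<Longrightarrow> k \<le> l \<Longrightarrow> X \<theta> k = x k) \<Longrightarrow>
       (\<And>i. i \<in> {1..K} \<Longrightarrow> (\<lambda>\<theta>. eval1 (q i) (X \<theta>) \<theta>) integrable_on delay_interval \<tau> i) \<Longrightarrow>
       \<alpha> * \<tau> K * (norm (x 1))\<^sup>2 \<le> (\<Sum>i=1..K. integral (delay_interval \<tau> i) (\<lambda>\<theta>. eval1 (q i) (X \<theta>) \<theta>))"
proof -
  obtain t \<alpha> where \<alpha>: "\<alpha> > 0"
    and t: "\<And>i. i \<in> {1..K} \<Longrightarrow> t i \<in> rpolys (insert Theta (vector_vars l)) d"
    and s: "\<And>i. i \<in> {1..K} \<Longrightarrow> q i - t i - rpoly_const \<alpha> * sq_norm_x1 \<in> sos (insert Theta (vector_vars (l + 1)))"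
    and t0: "\<And>x. (\<Sum>i=1..K. integral (delay_interval \<tau> i) (\<lambda>\<theta>. eval1 (t i) x \<theta>)) = 0"
    using q unfolding Xi_gen_def by blast
  have telescope: "(\<Sum>i=1..N. \<tau> i - \<tau> (i - 1)) = \<tau> N" for N
    by (induction N) (auto simp: \<tau>0)
  show ?thesis
  proof (rule that[OF \<alpha>])
    fix x :: "nat \<Rightarrow> real ^ 'n" and X
    assume X: "\<And>\<theta> k. 1 \<le> k \<Longrightarrow> k \<le> l \<Longrightarrow> X \<theta> k = x k"
      and int: "\<And>i. i \<in> {1..K} \<Longrightarrow> (\<lambda>\<theta>. eval1 (q i) (X \<theta>) \<theta>) integrable_on delay_interval \<tau> i"
    have "\<alpha> * \<tau> K * (norm (x 1))\<^sup>2 = (\<Sum>i=1..K. integral (delay_interval \<tau> i) (\<lambda>\<theta>. eval1 (t i) x \<theta>))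
        + (\<Sum>i=1..K. (\<tau> i - \<tau> (i - 1)) * (\<alpha> * (norm (x 1))\<^sup>2))"
      unfolding t0 sum_distrib_right[symmetric] telescope by simp
    also have "\<dots> = (\<Sum>i=1..K. integral (delay_interval \<tau> i) (\<lambda>\<theta>. eval1 (t i) x \<theta> + \<alpha> * (norm (x 1))\<^sup>2))"
      unfolding sum.distrib[symmetric] delay_interval_def
      by (intro sum.cong refl, subst integral_add)
         (use mono in \<open>auto intro!: integrable_continuous_interval continuous_eval1\<close>)
    also have "\<dots> \<le> (\<Sum>i=1..K. integral (delay_interval \<tau> i) (\<lambda>\<theta>. eval1 (q i) (X \<theta>) \<theta>))"
    proof (intro sum_mono integral_le int)
      fix i assume i: "i \<in> {1..K}"
      show "(\<lambda>\<theta>. eval1 (t i) x \<theta> + \<alpha> * (norm (x 1))\<^sup>2) integrable_on delay_interval \<tau> i"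
        unfolding delay_interval_def
        by (intro integrable_continuous_interval continuous_intros continuous_eval1)
      fix \<theta>
      have "eval1 (t i) (X \<theta>) \<theta> = eval1 (t i) x \<theta>"
        by (rule eval1_cong_vector_vars[OF t[OF i]]) (simp add: X)
      moreover have "eval1 (q i - t i - rpoly_const \<alpha> * sq_norm_x1) (X \<theta>) \<theta> \<ge> 0"
        unfolding eval2_def by (rule rpoly_eval_sos_nonneg[OF s[OF i]])
      moreover have "eval1 (q i - t i - rpoly_const \<alpha> * sq_norm_x1) (X \<theta>) \<theta> =
          eval1 (q i) (X \<theta>) \<theta> - eval1 (t i) (X \<theta>) \<theta> - \<alpha> * (norm (X \<theta> 1))\<^sup>2"
        unfolding eval2_sq_norm_x1[of "X \<theta>" \<theta> 0, symmetric]
        by (simp add: eval2_def rpoly_eval_diff rpoly_eval_mult rpoly_eval_const)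
      ultimately show "eval1 (t i) x \<theta> + \<alpha> * (norm (x 1))\<^sup>2 \<le> eval1 (q i) (X \<theta>) \<theta>"
        using X[of 1 \<theta>] l by simp
    qed
    finally show "\<alpha> * \<tau> K * (norm (x 1))\<^sup>2 \<le> (\<Sum>i=1..K. integral (delay_interval \<tau> i) (\<lambda>\<theta>. eval1 (q i) (X \<theta>) \<theta>))" .
  qed
qed

section \<open>Lyapunov--Krasovskii functionals\<close>

lemma has_derivative_le_imp_increment_le:
  fixes u :: "real \<Rightarrow> real"
  assumes "a \<le> b"
    and "\<And>s. a \<le> s \<Longrightarrow> s \<le> b \<Longrightarrow> \<exists>D. (u has_real_derivative D) (at s within {a..b}) \<and> D \<le> r"
  shows "u b - u a \<le> r * (b - a)"
proof -
  obtain u' where u': "\<And>s. a \<le> s \<Longrightarrow> s \<le> b \<Longrightarrow> (u has_real_derivative u' s) (at s within {a..b}) \<and> u' s \<le> r"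
    using assms(2) by metis
  have "\<exists>s\<in>{a..b}. u b - u a = u' s * (b - a)"
    by (rule mvt_very_simple[OF assms(1)]) (use u' in \<open>auto simp: has_field_derivative_def\<close>)
  then show ?thesis
    using u' assms(1) by (auto intro!: mult_right_mono)
qed

lemma norm_increment_le:
  fixes x :: "real \<Rightarrow> 'a::real_normed_vector"
  assumes "a \<le> b"
    and "\<And>s. a \<le> s \<Longrightarrow> s \<le> b \<Longrightarrow> (x has_vector_derivative x' s) (at s within {a..b})"
    and "\<And>s. a \<le> s \<Longrightarrow> s \<le> b \<Longrightarrow> norm (x' s) \<le> L"
  shows "norm (x b - x a) \<le> L * (b - a)"
proof -
  have "norm (x b - x a) \<le> L * norm (b - a)"
  proof (rule differentiable_bound[of "{a..b}"])
    show "(x has_derivative (\<lambda>h. h *\<^sub>R x' s)) (at s within {a..b})" if "s \<in> {a..b}" for s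
      using assms(2)[of s] that by (simp add: has_vector_derivative_def)
    show "onorm (\<lambda>h. h *\<^sub>R x' s) \<le> L" if "s \<in> {a..b}" for s
      using assms(3)[of s] that by (intro onorm_le) (auto simp: mult.commute[of L] intro!: mult_left_mono)
  qed (use assms(1) in auto)
  then show ?thesis using assms(1) by simp
qed

text \<open>A trajectory of speed at most \<open>L\<close> that is at distance \<open>\<epsilon>\<close> from the origin has been at distance at
  least \<open>\<epsilon> / 2\<close> for the time \<open>\<epsilon> / (2 L)\<close>; during this time \<open>U\<close> decreases at rate at least \<open>c (\<epsilon> / 2)\<^sup>2\<close>.\<close>

lemma energy_drop:
  fixes x :: "real \<Rightarrow> 'a::real_normed_vector"
  assumes pos: "\<epsilon> > 0" "L > 0" "c > 0"
    and U: "\<And>s. s \<in> {t - \<epsilon> / (2 * L)..t} \<Longrightarrow>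
        \<exists>D. (U has_real_derivative D) (at s within {t - \<epsilon> / (2 * L)..t}) \<and> D \<le> - c * (norm (x s))\<^sup>2"
    and x': "\<And>s. s \<in> {t - \<epsilon> / (2 * L)..t} \<Longrightarrow>
        (x has_vector_derivative x' s) (at s within {t - \<epsilon> / (2 * L)..t}) \<and> norm (x' s) \<le> L"
    and big: "norm (x t) \<ge> \<epsilon>"
  shows "U t + c * \<epsilon> ^ 3 / (8 * L) \<le> U (t - \<epsilon> / (2 * L))"
proof -
  let ?a = "t - \<epsilon> / (2 * L)"
  have at: "?a \<le> t" using pos by simp
  have half: "norm (x s) \<ge> \<epsilon> / 2" if "s \<in> {?a..t}" for s
  proof -
    have "norm (x t - x s) \<le> L * (t - s)"
      by (rule norm_increment_le[where x' = x'])
         (use that x' has_vector_derivative_within_subset[of x _ _ "{?a..t}" "{s..t}"] in auto)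
    also have "\<dots> \<le> L * (\<epsilon> / (2 * L))"
      using that pos by (intro mult_left_mono) auto
    also have "\<dots> = \<epsilon> / 2" using pos by simp
    finally show ?thesis
      using big norm_triangle_ineq2[of "x t" "x s"] by simp
  qed
  have "U t - U ?a \<le> - c * (\<epsilon> / 2)\<^sup>2 * (t - ?a)"
  proof (rule has_derivative_le_imp_increment_le[OF at])
    fix s assume s: "?a \<le> s" "s \<le> t"
    then obtain D where D: "(U has_real_derivative D) (at s within {?a..t})" "D \<le> - c * (norm (x s))\<^sup>2"
      using U[of s] by auto
    have "(\<epsilon> / 2)\<^sup>2 \<le> (norm (x s))\<^sup>2"
      using half[of s] s pos by (intro power_mono) auto
    then have "c * (\<epsilon> / 2)\<^sup>2 \<le> c * (norm (x s))\<^sup>2"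
      using pos by (intro mult_left_mono) auto
    with D show "\<exists>D. (U has_real_derivative D) (at s within {?a..t}) \<and> D \<le> - c * (\<epsilon> / 2)\<^sup>2"
      by (intro exI[of _ D]) auto
  qed
  also have "- c * (\<epsilon> / 2)\<^sup>2 * (t - ?a) = - (c * \<epsilon> ^ 3 / (8 * L))"
    using pos by (simp add: field_simps power2_eq_square power3_eq_cube)
  finally show ?thesis by simp
qed

lemma continuous_on_PiE_bounded:
  fixes f :: "(nat \<Rightarrow> real ^ 'n) \<Rightarrow> real ^ 'n::finite"
  assumes "continuous_on ({0..K} \<rightarrow>\<^sub>E UNIV) f"
  obtains L where "L > 0" "\<And>y. (\<And>k. k \<le> K \<Longrightarrow> norm (y k) \<le> M) \<Longrightarrow> norm (f (\<lambda>k\<in>{0..K}. y k)) \<le> L"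
proof -
  let ?C = "{0..K} \<rightarrow>\<^sub>E cball (0 :: real ^ 'n) M"
  have "?C = PiE UNIV (\<lambda>k. if k \<le> K then cball 0 M else {undefined})"
    by (auto simp: PiE_def Pi_def extensional_def split: if_splits)
  moreover have "compactin (product_topology (\<lambda>_. euclidean) UNIV) 
      (PiE UNIV (\<lambda>k. if k \<le> K then cball (0 :: real ^ 'n) M else {undefined}))"
    by (subst compactin_PiE) auto
  ultimately have "compact ?C"
    by (simp add: euclidean_product_topology)
  moreover have "continuous_on ?C f"
    by (rule continuous_on_subset[OF assms]) auto
  ultimately have "bounded (f ` ?C)"
    by (intro compact_imp_bounded compact_continuous_image)
  then obtain L where L: "L > 0" "\<And>z. z \<in> ?C \<Longrightarrow> norm (f z) \<le> L"
    unfolding bounded_pos by auto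
  show ?thesis
    by (rule that[OF L(1)]) (auto intro!: L(2))
qed

lemma solution_continuous:
  assumes tauK_nonneg: "0 \<le> \<tau> K" and "continuous_on {- \<tau> K..0} \<phi>" and "is_solution K \<tau> f \<phi> x"
  shows "continuous_on {- \<tau> K..} x"
proof -
  have 1: "continuous_on {- \<tau> K..0} x"
    using assms(2,3) by (subst continuous_on_cong[OF refl, of _ _ \<phi>]) (auto simp: is_solution_def)
  have 2: "continuous_on {0..} x"
    using assms(3) unfolding is_solution_def
    by (auto simp: continuous_on_eq_continuous_within intro: has_vector_derivative_continuous)
  have "continuous_on ({- \<tau> K..0} \<union> {0..}) x"
    by (rule continuous_on_closed_Un[OF _ _ 1 2]) auto
  moreover have "{- \<tau> K..0} \<union> {0..} = {- \<tau> K..}"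
    using tauK_nonneg by auto
  ultimately show ?thesis by simp
qed

text \<open>The classical upper bound of \<open>V \<psi>\<close> by a function of \<open>|\<psi>|\<close> that vanishes at \<open>0\<close> fails as soon as
  \<open>V 0 \<noteq> 0\<close>; sequential continuity of \<open>V\<close> at the zero history takes its place.\<close>

locale lyapunov_krasovskii =
  fixes K :: nat and \<tau> :: "nat \<Rightarrow> real"
    and f :: "(nat \<Rightarrow> real ^ 'n) \<Rightarrow> real ^ 'n::finite"
    and V :: "(real \<Rightarrow> real ^ 'n) \<Rightarrow> real" and c :: real
  assumes delays: "\<And>k. k \<le> K \<Longrightarrow> 0 \<le> \<tau> k \<and> \<tau> k \<le> \<tau> K"
    and f_cont: "continuous_on ({0..K} \<rightarrow>\<^sub>E UNIV) f"
    and c_pos: "c > 0"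
    and V_lower: "\<And>\<psi>. continuous_on {- \<tau> K..0} \<psi> \<Longrightarrow> c * (norm (\<psi> 0))\<^sup>2 \<le> V \<psi>"
    and V_decay: "\<And>\<phi> x t. continuous_on {- \<tau> K..0} \<phi> \<Longrightarrow> is_solution K \<tau> f \<phi> x \<Longrightarrow> t \<ge> 0 \<Longrightarrow>
        \<exists>D. ((\<lambda>s. V (\<lambda>\<theta>. x (s + \<theta>))) has_real_derivative D) (at t within {0..})
          \<and> D \<le> - c * (norm (x t))\<^sup>2"
    and V_cont: "\<And>\<psi>. (\<And>n. continuous_on {- \<tau> K..0} (\<psi> n)) \<Longrightarrow>
        uniform_limit {- \<tau> K..0} \<psi> (\<lambda>_. 0) sequentially \<Longrightarrow> (\<lambda>n. V (\<psi> n)) \<longlonglongrightarrow> V (\<lambda>_. 0)"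
begin

lemma tauK_nonneg: "0 \<le> \<tau> K"
  using delays[of K] by simp

context
  fixes \<phi> x U
  assumes phi: "continuous_on {- \<tau> K..0} \<phi>" and sol: "is_solution K \<tau> f \<phi> x"
  defines "U \<equiv> \<lambda>t. V (\<lambda>\<theta>. x (t + \<theta>))"
begin

lemma state_continuous: "t \<ge> 0 \<Longrightarrow> continuous_on {- \<tau> K..0} (\<lambda>\<theta>. x (t + \<theta>))"
  by (rule continuous_on_compose2[OF solution_continuous[OF tauK_nonneg phi sol]]) (auto intro!: continuous_intros)

lemma U_decay:
  "0 \<le> a \<Longrightarrow> s \<in> {a..b} \<Longrightarrow>
     \<exists>D. (U has_real_derivative D) (at s within {a..b}) \<and> D \<le> - c * (norm (x s))\<^sup>2"
  using V_decay[OF phi sol, of s] unfolding U_def[symmetric]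
  by (force intro: DERIV_subset)

lemma U_antimono: "0 \<le> a \<Longrightarrow> a \<le> b \<Longrightarrow> U b \<le> U a"
proof -
  assume "0 \<le> a" "a \<le> b"
  have "U b - U a \<le> 0 * (b - a)"
  proof (rule has_derivative_le_imp_increment_le[OF \<open>a \<le> b\<close>])
    fix s assume "a \<le> s" "s \<le> b"
    then obtain D where "(U has_real_derivative D) (at s within {a..b})" "D \<le> - c * (norm (x s))\<^sup>2"
      using U_decay[OF \<open>0 \<le> a\<close>, of s b] by auto
    moreover have "- c * (norm (x s))\<^sup>2 \<le> 0" using c_pos by simp
    ultimately show "\<exists>D. (U has_real_derivative D) (at s within {a..b}) \<and> D \<le> 0"
      by (meson order_trans)
  qed
  then show ?thesis by simp
qed

lemma U_lower: "t \<ge> 0 \<Longrightarrow> c * (norm (x t))\<^sup>2 \<le> U t"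
  using V_lower[OF state_continuous, of t] by (simp add: U_def)

lemma U_nonneg: "t \<ge> 0 \<Longrightarrow> 0 \<le> U t"
  using U_lower[of t] c_pos by (smt (verit) mult_nonneg_nonneg zero_le_power2)

lemma solution_bounded: "bounded (x ` {- \<tau> K..})"
proof -
  have "bounded (x ` {- \<tau> K..0})"
    by (intro compact_imp_bounded compact_continuous_image
        continuous_on_subset[OF solution_continuous[OF tauK_nonneg phi sol]]) auto
  moreover have "bounded (x ` {0..})"
  proof (rule boundedI)
    fix z assume "z \<in> x ` {0..}"
    then obtain t where t: "t \<ge> 0" "z = x t" by auto
    have "c * (norm (x t))\<^sup>2 \<le> U 0"
      using U_lower[OF t(1)] U_antimono[of 0 t] t by simp
    then have "(norm (x t))\<^sup>2 \<le> U 0 / c" using c_pos by (simp add: field_simps)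
    then show "norm z \<le> sqrt (U 0 / c)" using t real_le_rsqrt by simp
  qed
  ultimately have "bounded (x ` {- \<tau> K..0} \<union> x ` {0..})" by simp
  moreover have "x ` {- \<tau> K..} \<subseteq> x ` {- \<tau> K..0} \<union> x ` {0..}"
    unfolding image_Un[symmetric] by (intro image_mono) auto
  ultimately show ?thesis by (rule bounded_subset)
qed

lemma solution_derivative:
  assumes M: "\<And>s. - \<tau> K \<le> s \<Longrightarrow> s \<le> b \<Longrightarrow> norm (x s) \<le> M"
    and L: "\<And>y. (\<And>k. k \<le> K \<Longrightarrow> norm (y k) \<le> M) \<Longrightarrow> norm (f (\<lambda>k\<in>{0..K}. y k)) \<le> L"
    and "0 \<le> a" "s \<in> {a..b}"
  shows "(x has_vector_derivative f (\<lambda>k\<in>{0..K}. x (s - \<tau> k))) (at s within {a..b})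
     \<and> norm (f (\<lambda>k\<in>{0..K}. x (s - \<tau> k))) \<le> L"
proof
  show "(x has_vector_derivative f (\<lambda>k\<in>{0..K}. x (s - \<tau> k))) (at s within {a..b})"
    using sol assms(3,4) unfolding is_solution_def
    by (auto intro!: has_vector_derivative_within_subset[of x _ _ "{0..}" "{a..b}"])
  show "norm (f (\<lambda>k\<in>{0..K}. x (s - \<tau> k))) \<le> L"
  proof (rule L)
    fix k assume "k \<le> K"
    then show "norm (x (s - \<tau> k)) \<le> M"
      using delays[of k] assms(3,4) by (intro M) auto
  qed
qed

text \<open>If \<open>|x| \<ge> \<epsilon>\<close> at arbitrarily late times, each such time costs the same amount of energy, which
  contradicts the convergence of the nonincreasing function \<open>U\<close>.\<close>

lemma solution_tendsto_zero: "(x \<longlongrightarrow> 0) at_top"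
proof (rule ccontr)
  assume "\<not> (x \<longlongrightarrow> 0) at_top"
  then obtain \<epsilon> where e: "\<epsilon> > 0" and freq: "\<And>T. \<exists>t\<ge>T. norm (x t) \<ge> \<epsilon>"
    unfolding tendsto_iff eventually_at_top_linorder by (auto simp: not_less)
  obtain M where M: "\<And>s. - \<tau> K \<le> s \<Longrightarrow> norm (x s) \<le> M"
    using solution_bounded unfolding bounded_pos by auto
  obtain L where L: "L > 0"
    "\<And>y. (\<And>k. k \<le> K \<Longrightarrow> norm (y k) \<le> M) \<Longrightarrow> norm (f (\<lambda>k\<in>{0..K}. y k)) \<le> L"
    by (rule continuous_on_PiE_bounded[OF f_cont]) blast
  define l where "l = Inf (U ` {0..})"
  have bdd: "bdd_below (U ` {0..})"
    by (rule bdd_belowI[of _ 0]) (auto intro: U_nonneg)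
  have "l < l + c * \<epsilon> ^ 3 / (8 * L)"
    using e L c_pos by simp
  then obtain t0 where t0: "t0 \<ge> 0" "U t0 < l + c * \<epsilon> ^ 3 / (8 * L)"
    unfolding l_def by (subst (asm) cInf_less_iff) (use bdd in auto)
  obtain t where t: "t \<ge> t0 + \<epsilon> / (2 * L)" "norm (x t) \<ge> \<epsilon>"
    using freq by blast
  have ge: "t - \<epsilon> / (2 * L) \<ge> 0" using t t0 by simp
  have "U t + c * \<epsilon> ^ 3 / (8 * L) \<le> U (t - \<epsilon> / (2 * L))"
    by (rule energy_drop[OF e L(1) c_pos U_decay[OF ge]
          solution_derivative[OF M L(2) ge] t(2)]) auto
  also have "\<dots> \<le> U t0" using t t0 by (intro U_antimono) auto
  finally have "U t < l" using t0 by simp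
  moreover have "l \<le> U t"
    unfolding l_def using ge e L by (intro cInf_lower bdd imageI) (use order_trans[OF ge, of t] in simp)
  ultimately show False by simp
qed

text \<open>Since the histories of \<open>x\<close> tend to zero and \<open>U\<close> is nonincreasing, \<open>V 0\<close> is its limit.\<close>

lemma V_zero_le: 
  assumes "t \<ge> 0"
  shows "V (\<lambda>_. 0) \<le> U t"
proof (rule LIMSEQ_le_const2)
  show "(\<lambda>n. V (\<lambda>\<theta>. x (real n + \<theta>))) \<longlonglongrightarrow> V (\<lambda>_. 0)"
  proof (rule V_cont)
    show "uniform_limit {- \<tau> K..0} (\<lambda>n \<theta>. x (real n + \<theta>)) (\<lambda>_. 0) sequentially"
    proof (rule uniform_limitI)
      fix e :: real assume "e > 0"
      then have "\<forall>\<^sub>F s in at_top. norm (x s) < e"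
        using solution_tendsto_zero by (auto simp: tendsto_iff)
      then obtain T where T: "\<And>s. s \<ge> T \<Longrightarrow> norm (x s) < e"
        by (auto simp: eventually_at_top_linorder)
      have "\<forall>\<^sub>F n in sequentially. real n \<ge> T + \<tau> K"
        using filterlim_real_sequentially by (simp add: filterlim_at_top)
      then show "\<forall>\<^sub>F n in sequentially. \<forall>\<theta>\<in>{- \<tau> K..0}. dist (x (real n + \<theta>)) 0 < e"
        by eventually_elim (auto intro!: T)
    qed
  qed (auto intro: state_continuous)
  obtain N :: nat where "real N \<ge> t" using real_arch_simple by blast
  then show "\<exists>N. \<forall>n\<ge>N. V (\<lambda>\<theta>. x (real n + \<theta>)) \<le> U t"
    using assms U_antimono[of t] by (intro exI[of _ N]) (auto simp: U_def)
qed

text \<open>At the first time \<open>T\<close> with \<open>|x T| = \<epsilon>\<close> the velocity has been bounded by \<open>L\<close> throughout, so that the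
  energy has dropped by the amount of \<open>energy_drop\<close>; but then \<open>U T < V 0\<close>.\<close>

lemma solution_stays_small:
  assumes e: "\<epsilon> > 0" and L: "L > 0"
    "\<And>y. (\<And>k. k \<le> K \<Longrightarrow> norm (y k) \<le> \<epsilon>) \<Longrightarrow> norm (f (\<lambda>k\<in>{0..K}. y k)) \<le> L"
    and init: "\<And>\<theta>. \<theta> \<in> {- \<tau> K..0} \<Longrightarrow> norm (\<phi> \<theta>) \<le> \<epsilon> / 2"
    and U0: "U 0 < V (\<lambda>_. 0) + c * \<epsilon> ^ 3 / (8 * L)"
    and t: "t \<ge> - \<tau> K"
  shows "norm (x t) < \<epsilon>"
proof (rule ccontr)
  assume "\<not> norm (x t) < \<epsilon>"
  have init_x: "norm (x s) \<le> \<epsilon> / 2" if "s \<in> {- \<tau> K..0}" for s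
    using sol init[OF that] that by (simp add: is_solution_def)
  define S where "S = {s \<in> {- \<tau> K..t}. norm (x s) \<ge> \<epsilon>}"
  have "closed S"
    unfolding S_def
    by (intro continuous_on_closed_Collect_le continuous_intros
        continuous_on_subset[OF solution_continuous[OF tauK_nonneg phi sol]]) auto
  moreover have "bounded S"
    by (rule bounded_subset[of "{- \<tau> K..t}"]) (auto simp: S_def)
  ultimately have "compact S" by (simp add: compact_eq_bounded_closed)
  moreover have "S \<noteq> {}" using \<open>\<not> norm (x t) < \<epsilon>\<close> t by (auto simp: S_def)
  ultimately obtain T where T: "T \<in> S" and first: "\<And>s. s \<in> S \<Longrightarrow> T \<le> s"
    using compact_attains_inf by metis
  have before: "norm (x s) < \<epsilon>" if "- \<tau> K \<le> s" "s < T" for s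
    using first[of s] that T by (force simp: S_def)
  have "T > 0" using T init_x[of T] e by (force simp: S_def)
  have xT: "norm (x T) \<le> \<epsilon>"
  proof (rule tendsto_upperbound)
    have "(x \<longlongrightarrow> x T) (at T within {0..})"
      using solution_continuous[OF tauK_nonneg phi sol] \<open>T > 0\<close> tauK_nonneg continuous_on_subset[of "{- \<tau> K..}" x "{0..}"]
      by (auto simp: continuous_on)
    then have "(x \<longlongrightarrow> x T) (at T within {0..<T})"
      by (rule tendsto_within_subset) auto
    then show "((\<lambda>s. norm (x s)) \<longlongrightarrow> norm (x T)) (at T within {0..<T})"
      by (rule tendsto_norm)
    show "\<forall>\<^sub>F s in at T within {0..<T}. norm (x s) \<le> \<epsilon>"
      unfolding eventually_at_filter using before tauK_nonneg
      by (intro always_eventually) (auto intro!: less_imp_le)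
    show "at T within {0..<T} \<noteq> bot"
      using \<open>T > 0\<close> by (simp add: at_within_eq_bot_iff)
  qed
  have M: "norm (x s) \<le> \<epsilon>" if "- \<tau> K \<le> s" "s \<le> T" for s
    using before[of s] xT that by (cases "s = T") auto
  have x': "(x has_vector_derivative f (\<lambda>k\<in>{0..K}. x (s - \<tau> k))) (at s within {a..T})
     \<and> norm (f (\<lambda>k\<in>{0..K}. x (s - \<tau> k))) \<le> L" if "0 \<le> a" "s \<in> {a..T}" for a s
    by (rule solution_derivative[where M = \<epsilon>]) (use M L(2) that in auto)
  have "norm (x T - x 0) \<le> L * (T - 0)"
    by (rule norm_increment_le[where x' = "\<lambda>s. f (\<lambda>k\<in>{0..K}. x (s - \<tau> k))"])
       (use \<open>T > 0\<close> x'[of 0] in auto)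
  moreover have "norm (x T) - norm (x 0) \<ge> \<epsilon> / 2"
    using T init_x[of 0] tauK_nonneg by (auto simp: S_def)
  ultimately have "\<epsilon> / 2 \<le> L * T"
    using norm_triangle_ineq2[of "x T" "x 0"] by simp
  \<comment> \<open>The excursion takes place after time \<open>0\<close>, where \<open>U\<close> is known to decay.\<close>
  then have ge: "T - \<epsilon> / (2 * L) \<ge> 0" using L(1) by (simp add: field_simps)
  have "U T + c * \<epsilon> ^ 3 / (8 * L) \<le> U (T - \<epsilon> / (2 * L))"
    by (rule energy_drop[OF e L(1) c_pos U_decay[OF ge] x'[OF ge]])
       (use T in \<open>auto simp: S_def\<close>)
  also have "\<dots> \<le> U 0" using ge by (intro U_antimono) auto
  finally show False using U0 V_zero_le[of T] \<open>T > 0\<close> by simp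
qed

end

lemma V_near_zero:
  assumes "\<kappa> > 0"
  obtains \<delta> where "\<delta> > 0" 
    "\<And>\<psi>. continuous_on {- \<tau> K..0} \<psi> \<Longrightarrow> (\<And>\<theta>. \<theta> \<in> {- \<tau> K..0} \<Longrightarrow> norm (\<psi> \<theta>) < \<delta>) \<Longrightarrow>
       V \<psi> < V (\<lambda>_. 0) + \<kappa>"
proof (rule ccontr)
  note that0 = that
  assume "\<not> thesis"
  have "\<exists>\<psi>. continuous_on {- \<tau> K..0} \<psi> \<and> (\<forall>\<theta>\<in>{- \<tau> K..0}. norm (\<psi> \<theta>) < \<delta>) \<and>
       \<not> V \<psi> < V (\<lambda>_. 0) + \<kappa>" if "\<delta> > 0" for \<delta>
    using that0[OF that] \<open>\<not> thesis\<close> by blast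
  then have "\<forall>n::nat. \<exists>\<psi>. continuous_on {- \<tau> K..0} \<psi> \<and>
      (\<forall>\<theta>\<in>{- \<tau> K..0}. norm (\<psi> \<theta>) < 1 / real (Suc n)) \<and> \<not> V \<psi> < V (\<lambda>_. 0) + \<kappa>"
    by simp
  then obtain \<psi> where \<psi>: "\<And>n. continuous_on {- \<tau> K..0} (\<psi> n)"
    "\<And>n \<theta>. \<theta> \<in> {- \<tau> K..0} \<Longrightarrow> norm (\<psi> n \<theta>) < 1 / real (Suc n)"
    "\<And>n. \<not> V (\<psi> n) < V (\<lambda>_. 0) + \<kappa>"
    by metis
  have "uniform_limit {- \<tau> K..0} \<psi> (\<lambda>_. 0) sequentially"
  proof (rule uniform_limitI)
    fix e :: real assume "e > 0"
    then have "\<forall>\<^sub>F n in sequentially. 1 / real (Suc n) < e"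
      using LIMSEQ_inverse_real_of_nat by (auto simp: tendsto_iff inverse_eq_divide)
    then show "\<forall>\<^sub>F n in sequentially. \<forall>\<theta>\<in>{- \<tau> K..0}. dist (\<psi> n \<theta>) 0 < e"
      by eventually_elim (use \<psi>(2) in \<open>force intro: less_trans\<close>)
  qed
  then have "(\<lambda>n. V (\<psi> n)) \<longlonglongrightarrow> V (\<lambda>_. 0)"
    by (rule V_cont[OF \<psi>(1)])
  then have "\<forall>\<^sub>F n in sequentially. V (\<psi> n) < V (\<lambda>_. 0) + \<kappa>"
    by (rule order_tendstoD) (use assms in simp)
  with \<psi>(3) show False by simp
qed

theorem global_asymptotic_stability: "globally_asymptotically_stable K \<tau> f"
  unfolding globally_asymptotically_stable_def
proof (intro conjI allI impI)
  fix \<phi> x assume "continuous_on {- \<tau> K..0} \<phi>" "is_solution K \<tau> f \<phi> x"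
  then show "bounded (x ` {- \<tau> K..})" "(x \<longlongrightarrow> 0) at_top"
    by (rule solution_bounded, rule solution_tendsto_zero)
next
  fix \<epsilon> :: real assume "\<epsilon> > 0"
  \<comment> \<open>Half of \<open>\<epsilon>\<close> leaves room for the supremum, which need not be attained.\<close>
  define e where "e = \<epsilon> / 2"
  have e: "e > 0" "e < \<epsilon>" using \<open>\<epsilon> > 0\<close> by (auto simp: e_def)
  obtain L where L: "L > 0"
    "\<And>y. (\<And>k. k \<le> K \<Longrightarrow> norm (y k) \<le> e) \<Longrightarrow> norm (f (\<lambda>k\<in>{0..K}. y k)) \<le> L"
    by (rule continuous_on_PiE_bounded[OF f_cont]) blast
  have "c * e ^ 3 / (8 * L) > 0" using e L c_pos by simp
  then obtain \<delta> where \<delta>: "\<delta> > 0" 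
    "\<And>\<psi>. continuous_on {- \<tau> K..0} \<psi> \<Longrightarrow> (\<And>\<theta>. \<theta> \<in> {- \<tau> K..0} \<Longrightarrow> norm (\<psi> \<theta>) < \<delta>) \<Longrightarrow>
       V \<psi> < V (\<lambda>_. 0) + c * e ^ 3 / (8 * L)"
    by (rule V_near_zero) blast
  show "\<exists>\<delta>>0. \<forall>\<phi> x. continuous_on {- \<tau> K..0} \<phi> \<longrightarrow> is_solution K \<tau> f \<phi> x \<longrightarrow>
        (SUP s\<in>{- \<tau> K..0}. norm (\<phi> s)) < \<delta> \<longrightarrow> (SUP t\<in>{- \<tau> K..}. norm (x t)) < \<epsilon>"
  proof (intro exI[of _ "min \<delta> (e / 2)"] conjI allI impI)
    fix \<phi> x assume phi: "continuous_on {- \<tau> K..0} \<phi>" and sol: "is_solution K \<tau> f \<phi> x"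
      and small: "(SUP s\<in>{- \<tau> K..0}. norm (\<phi> s)) < min \<delta> (e / 2)"
    have "bdd_above ((\<lambda>s. norm (\<phi> s)) ` {- \<tau> K..0})"
      by (intro bounded_imp_bdd_above compact_imp_bounded compact_continuous_image
          continuous_on_norm phi) auto
    then have phi_small: "norm (\<phi> s) < min \<delta> (e / 2)" if "s \<in> {- \<tau> K..0}" for s
      using cSUP_upper[OF that, of "\<lambda>s. norm (\<phi> s)"] small by simp
    have V_small: "V (\<lambda>\<theta>. x (0 + \<theta>)) < V (\<lambda>_. 0) + c * e ^ 3 / (8 * L)"
      using phi_small sol by (intro \<delta>(2) state_continuous[OF phi sol]) (auto simp: is_solution_def)
    have "norm (x t) < e" if "t \<ge> - \<tau> K" for t
      
    proof (rule solution_stays_small[OF phi sol e(1) L _ V_small that])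
      show "norm (\<phi> \<theta>) \<le> e / 2" if "\<theta> \<in> {- \<tau> K..0}" for \<theta>
        using phi_small[OF that] by simp
    qed auto
    then have "(SUP t\<in>{- \<tau> K..}. norm (x t)) \<le> e"
      by (intro cSUP_least) (auto intro: less_imp_le)
    then show "(SUP t\<in>{- \<tau> K..}. norm (x t)) < \<epsilon>" using e by simp
  qed (use \<delta> e in auto)
qed

end

section \<open>Stability from the polynomial certificate\<close>

theorem mainTheorem9:
  fixes K d :: nat
    and \<tau> :: "nat \<Rightarrow> real"
    and f :: "(nat \<Rightarrow> real ^ 'n) \<Rightarrow> real ^ 'n"
    and g ghat :: "nat \<Rightarrow> 'n indet rpoly"
    and h hhat :: "nat \<Rightarrow> nat \<Rightarrow> 'n indet rpoly"
  assumes "K \<ge> 1"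
    and "\<tau> 0 = 0" and "strict_mono_on {0..K} \<tau>"
    and "continuous_on ({0..K} \<rightarrow>\<^sub>E UNIV) f"
    and "f (\<lambda>k\<in>{0..K}. 0) = 0"
    and "uniquely_solvable K \<tau> f"
    and "even d"
    and "(\<lambda>i. rpoly_const (\<tau> i - \<tau> (i - 1)) * g i) \<in> Xi1 K \<tau> d"
    and "h \<in> Xi2 K \<tau> d" and "hhat \<in> Xi2 K \<tau> d"
    and "(\<lambda>i. - ghat i) \<in> Xi3 K \<tau> d"
    and "\<And>i y x \<theta>. i \<in> {1..K} \<Longrightarrow> \<theta> \<in> delay_interval \<tau> i \<Longrightarrow>
      eval1 (ghat i) (\<lambda>k. if k = K + 2 then x else y (k - 1)) \<theta> =
        eval1 (g i) (two_args (y 0) (y (i - 1))) (- \<tau> (i - 1))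
        - eval1 (g i) (two_args (y 0) (y i)) (- \<tau> i)
        + (\<tau> i - \<tau> (i - 1))
            * (grad (\<lambda>z. eval1 (g i) (two_args z x) \<theta>) (y 0) \<bullet> f (\<lambda>k\<in>{0..K}. y k))
        - (\<tau> i - \<tau> (i - 1)) * deriv (\<lambda>s. eval1 (g i) (two_args (y 0) x) s) \<theta>
        + (\<Sum>k=1..K. eval2 (h k i) (two_args (y (k - 1)) x) (- \<tau> (k - 1)) \<theta>
                    - eval2 (h k i) (two_args (y k) x) (- \<tau> k) \<theta>)
        + (\<Sum>k=1..K. eval2 (h i k) (two_args x (y (k - 1))) \<theta> (- \<tau> (k - 1))
                    - eval2 (h i k) (two_args x (y k)) \<theta> (- \<tau> k))"
    and "\<And>i j x x' \<theta> \<omega>. i \<in> {1..K} \<Longrightarrow> j \<in> {1..K} \<Longrightarrow>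
      \<theta> \<in> delay_interval \<tau> i \<Longrightarrow> \<omega> \<in> delay_interval \<tau> j \<Longrightarrow>
      eval2 (hhat i j) (two_args x x') \<theta> \<omega> =
        deriv (\<lambda>s. eval2 (h i j) (two_args x x') s \<omega>) \<theta>
        + deriv (\<lambda>s. eval2 (h i j) (two_args x x') \<theta> s) \<omega>"
  shows "globally_asymptotically_stable K \<tau> f"
proof -
  note \<tau>0 = assms(2) and ghat_rel = assms(12) and hhat_rel = assms(13)
  have \<tau>_mono: "\<tau> i \<le> \<tau> j" if "i \<le> j" "j \<le> K" for i j
    using strict_mono_onD[OF assms(3), of i j] that by (cases "i = j") auto
  have step: "\<tau> (i - 1) \<le> \<tau> i" if "i \<in> {1..K}" for i
    using that by (intro \<tau>_mono) auto
  have \<tau>K: "0 < \<tau> K"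
    using strict_mono_onD[OF assms(3), of 0 K] assms(1) \<tau>0 by simp
  have sub: "delay_interval \<tau> i \<subseteq> {- \<tau> K..0}" if "i \<in> {1..K}" for i
    using that \<tau>_mono[of i K] \<tau>_mono[of 0 "i - 1"] \<tau>0 by (auto simp: delay_interval_def)
  define \<Delta> where "\<Delta> i = \<tau> i - \<tau> (i - 1)" for i
  obtain \<alpha>1 where \<alpha>1: "\<alpha>1 > 0"
    "\<And>x X. (\<And>\<theta> k. 1 \<le> k \<Longrightarrow> k \<le> 1 \<Longrightarrow> X \<theta> k = x k) \<Longrightarrow>
       (\<And>i. i \<in> {1..K} \<Longrightarrow> (\<lambda>\<theta>. eval1 (rpoly_const (\<Delta> i) * g i) (X \<theta>) \<theta>) integrable_on delay_interval \<tau> i) \<Longrightarrow>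
       \<alpha>1 * \<tau> K * (norm (x 1))\<^sup>2 \<le>
         (\<Sum>i=1..K. integral (delay_interval \<tau> i) (\<lambda>\<theta>. eval1 (rpoly_const (\<Delta> i) * g i) (X \<theta>) \<theta>))"
    by (rule Xi_gen_integral_lower[OF assms(8)[unfolded Xi1_def, folded \<Delta>_def] order_refl \<tau>0 step]) blast+
  obtain \<alpha>3 where \<alpha>3: "\<alpha>3 > 0"
    "\<And>x X. (\<And>\<theta> k. 1 \<le> k \<Longrightarrow> k \<le> K + 1 \<Longrightarrow> X \<theta> k = x k) \<Longrightarrow>
       (\<And>i. i \<in> {1..K} \<Longrightarrow> (\<lambda>\<theta>. eval1 (- ghat i) (X \<theta>) \<theta>) integrable_on delay_interval \<tau> i) \<Longrightarrow>
       \<alpha>3 * \<tau> K * (norm (x 1))\<^sup>2 \<le>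
         (\<Sum>i=1..K. integral (delay_interval \<tau> i) (\<lambda>\<theta>. eval1 (- ghat i) (X \<theta>) \<theta>))"
    by (rule Xi_gen_integral_lower[OF assms(11)[unfolded Xi3_def] le_add2 \<tau>0 step]) blast+
  define V where "V \<psi> =
      (\<Sum>i=1..K. \<Delta> i * integral (delay_interval \<tau> i) (\<lambda>\<theta>. eval1 (g i) (two_args (\<psi> 0) (\<psi> \<theta>)) \<theta>))
    + (\<Sum>i=1..K. \<Sum>j=1..K. integral (delay_interval \<tau> i) (\<lambda>\<theta>. integral (delay_interval \<tau> j)
         (\<lambda>\<omega>. eval2 (h i j) (two_args (\<psi> \<theta>) (\<psi> \<omega>)) \<theta> \<omega>)))" for \<psi> :: "real \<Rightarrow> real ^ 'n"
  define c where "c = min \<alpha>1 \<alpha>3 * \<tau> K"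
  have c: "c > 0" "c * r \<le> \<alpha>1 * \<tau> K * r" "c * r \<le> \<alpha>3 * \<tau> K * r" if "r \<ge> 0" for r
    using \<alpha>1(1) \<alpha>3(1) \<tau>K that by (auto simp: c_def intro!: mult_right_mono)
  have "lyapunov_krasovskii K \<tau> f V c"
  proof
    show "0 \<le> \<tau> k \<and> \<tau> k \<le> \<tau> K" if "k \<le> K" for k
      using \<tau>_mono[of 0 k] \<tau>_mono[of k K] that \<tau>0 by simp
    show "continuous_on ({0..K} \<rightarrow>\<^sub>E UNIV) f" by fact
    show "c > 0" using c(1)[of 0] by simp
  next
    fix \<psi> :: "real \<Rightarrow> real ^ 'n" assume cont: "continuous_on {- \<tau> K..0} \<psi>"
    have cont_i: "continuous_on (delay_interval \<tau> i) \<psi>" if "i \<in> {1..K}" for i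
      using cont sub[OF that] by (rule continuous_on_subset)
    have gint: "continuous_on (delay_interval \<tau> i) (\<lambda>\<theta>. eval1 (g i) (two_args (\<psi> 0) (\<psi> \<theta>)) \<theta>)"
      if "i \<in> {1..K}" for i
      by (rule separated.continuous_F[OF separated_eval2]) (intro continuous_intros cont_i that)+
    have ev: "eval1 (rpoly_const (\<Delta> i) * g i) X \<theta> = \<Delta> i * eval1 (g i) X \<theta>" for i X \<theta>
      by (simp add: eval2_def rpoly_eval_mult rpoly_eval_const)
    have "c * (norm (\<psi> 0))\<^sup>2 \<le> \<alpha>1 * \<tau> K * (norm (\<psi> 0))\<^sup>2"
      by (rule c) simp
    also have "\<dots> \<le> (\<Sum>i=1..K. integral (delay_interval \<tau> i)
        (\<lambda>\<theta>. eval1 (rpoly_const (\<Delta> i) * g i) (two_args (\<psi> 0) (\<psi> \<theta>)) \<theta>))"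
      using gint unfolding ev delay_interval_def
      by (intro \<alpha>1(2)[where x = "\<lambda>_. \<psi> 0", unfolded ev delay_interval_def])
         (auto simp: two_args_def intro!: integrable_continuous_interval continuous_intros)
    also have "\<dots> \<le> V \<psi>"
      using Xi2_double_integral_nonneg[OF assms(9) cont_i] by (simp add: ev V_def)
    finally show "c * (norm (\<psi> 0))\<^sup>2 \<le> V \<psi>" .
  next
    fix \<psi> :: "nat \<Rightarrow> real \<Rightarrow> real ^ 'n"
    assume cont: "\<And>n. continuous_on {- \<tau> K..0} (\<psi> n)"
      and lim: "uniform_limit {- \<tau> K..0} \<psi> (\<lambda>_. 0) sequentially"
    have cont_i: "continuous_on {- \<tau> i..- \<tau> (i - 1)} (\<psi> n)" if "i \<in> {1..K}" for i n
      using cont sub[OF that] unfolding delay_interval_def by (rule continuous_on_subset)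
    have lim_i: "uniform_limit {- \<tau> i..- \<tau> (i - 1)} \<psi> (\<lambda>_. 0) sequentially" if "i \<in> {1..K}" for i
      using lim sub[OF that] unfolding delay_interval_def by (rule uniform_limit_on_subset)
    have lim_0: "(\<lambda>n. \<psi> n 0) \<longlonglongrightarrow> 0"
      using tendsto_uniform_limitI[OF lim, of 0] \<tau>K by simp
    show "(\<lambda>n. V (\<psi> n)) \<longlonglongrightarrow> V (\<lambda>_. 0)"
      unfolding V_def delay_interval_def
      by (intro tendsto_add tendsto_sum tendsto_mult tendsto_const
          separated.single_integral_tendsto[OF separated_eval2]
          separated.double_integral_tendsto[OF separated_eval2] cont_i lim_i lim_0)
  next
    fix \<phi> x t
    assume phi: "continuous_on {- \<tau> K..0} \<phi>" and sol: "is_solution K \<tau> f \<phi> x" and t: "(0::real) \<le> t"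
    \<comment> \<open>Solutions are unspecified before \<open>- \<tau> K\<close>; the constant extension to the left is continuous
      everywhere, and only its values on \<open>[- \<tau> K, \<infinity>)\<close> enter.\<close>
    define y where "y s = x (max s (- \<tau> K))" for s
    have yx: "y s = x s" if "s \<ge> - \<tau> K" for s using that by (simp add: y_def)
    have y: "continuous_on UNIV y"
      unfolding y_def using \<tau>K
      by (intro continuous_on_compose2[OF solution_continuous[OF _ phi sol]] continuous_intros) auto
    define v where "v = f (\<lambda>k\<in>{0..K}. y (t - \<tau> k))"
    have "(\<lambda>k\<in>{0..K}. y (t - \<tau> k)) = (\<lambda>k\<in>{0..K}. x (t - \<tau> k))"
    proof (rule restrict_ext)
      fix k assume "k \<in> {0..K}"
      then show "y (t - \<tau> k) = x (t - \<tau> k)"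
        using \<tau>_mono[of k K] t by (intro yx) auto
    qed
    then have "(x has_vector_derivative v) (at t within {0..})"
      using sol t by (simp add: is_solution_def v_def)
    then have y': "(y has_vector_derivative v) (at t within {0..})"
      using t \<tau>K by (elim has_vector_derivative_transform[rotated 2]) (auto intro!: yx)
    define I where "I i = {- \<tau> i..- \<tau> (i - 1)}" for i
    have I: "delay_interval \<tau> i = I i" for i by (simp add: I_def delay_interval_def)
    have V_y: "V (\<lambda>\<theta>. x (s + \<theta>)) = V (\<lambda>\<theta>. y (s + \<theta>))" if "s \<ge> 0" for s
    proof -
      have "x (s + \<theta>) = y (s + \<theta>)" if "\<theta> \<in> delay_interval \<tau> i" "i \<in> {1..K}" for i \<theta>
        using sub[OF that(2)] that(1) \<open>s \<ge> 0\<close> by (intro yx[symmetric]) auto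
      moreover have "x (s + 0) = y (s + 0)" using \<open>s \<ge> 0\<close> \<tau>K by (intro yx[symmetric]) auto
      ultimately show ?thesis
        unfolding V_def by (intro arg_cong2[where f = "(+)"] sum.cong refl arg_cong2[where f = "(*)"] integral_cong) auto
    qed
    \<comment> \<open>The terms of the relation for \<open>ghat\<close>, evaluated along the solution at time \<open>t\<close>.\<close>
    define bdry where "bdry i = eval1 (g i) (two_args (y t) (y (t - \<tau> (i - 1)))) (- \<tau> (i - 1))
        - eval1 (g i) (two_args (y t) (y (t - \<tau> i))) (- \<tau> i)" for i
    define J where "J i \<theta> = grad (\<lambda>z. eval1 (g i) (two_args z (y (t + \<theta>))) \<theta>) (y t) \<bullet> v
        - deriv (\<lambda>s. eval1 (g i) (two_args (y t) (y (t + \<theta>))) s) \<theta>" for i \<theta>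
    define H1 where "H1 k i \<theta> = eval2 (h k i) (two_args (y (t - \<tau> (k - 1))) (y (t + \<theta>))) (- \<tau> (k - 1)) \<theta>
        - eval2 (h k i) (two_args (y (t - \<tau> k)) (y (t + \<theta>))) (- \<tau> k) \<theta>" for k i \<theta>
    define H2 where "H2 i k \<theta> = eval2 (h i k) (two_args (y (t + \<theta>)) (y (t - \<tau> (k - 1)))) \<theta> (- \<tau> (k - 1))
        - eval2 (h i k) (two_args (y (t + \<theta>)) (y (t - \<tau> k))) \<theta> (- \<tau> k)" for i k \<theta>
    define HH where "HH i j = integral (I i) (\<lambda>\<theta>. integral (I j)
        (\<lambda>\<omega>. eval2 (hhat i j) (two_args (y (t + \<theta>)) (y (t + \<omega>))) \<theta> \<omega>))" for i j
    define Y where "Y \<theta> = (\<lambda>k. if k = K + 2 then y (t + \<theta>) else y (t - \<tau> (k - 1)))" for \<theta>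
    have shift: "continuous_on S (\<lambda>\<theta>. y (t + \<theta>))" for S
      by (rule continuous_on_compose2[OF y _ subset_UNIV]) (intro continuous_intros)
    have contJ: "continuous_on S (J i)" for S i
      unfolding J_def
      by (intro continuous_intros separated.continuous_single_integrand[OF separated_eval2] shift)
    have contH1: "continuous_on S (H1 k i)" for S k i
      unfolding H1_def
      by (intro continuous_on_diff separated.continuous_F[OF separated_eval2] continuous_on_const continuous_on_id shift)
    have contH2: "continuous_on S (H2 i k)" for S k i
      unfolding H2_def
      by (intro continuous_on_diff separated.continuous_F[OF separated_eval2] continuous_on_const continuous_on_id shift)
    note cont = contJ contH1 contH2
    have ghat_eq: "eval1 (ghat i) (Y \<theta>) \<theta> = bdry i + \<Delta> i * J i \<theta> + (\<Sum>k=1..K. H1 k i \<theta>) + (\<Sum>k=1..K. H2 i k \<theta>)"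
      if "i \<in> {1..K}" "\<theta> \<in> I i" for i \<theta>
      using ghat_rel[OF that[folded I], of "y (t + \<theta>)" "\<lambda>k. y (t - \<tau> k)"]
      unfolding Y_def bdry_def J_def H1_def H2_def v_def \<Delta>_def \<tau>0 by (simp add: right_diff_distrib)
    have ghat_cont: "continuous_on (I i) (\<lambda>\<theta>. eval1 (ghat i) (Y \<theta>) \<theta>)" if "i \<in> {1..K}" for i
      by (subst continuous_on_cong[OF refl ghat_eq[OF that]]) (auto intro!: continuous_intros cont)
    have ghat_int: "integral (I i) (\<lambda>\<theta>. eval1 (ghat i) (Y \<theta>) \<theta>) =
        \<Delta> i * (bdry i + integral (I i) (J i)) + (\<Sum>k=1..K. integral (I i) (H1 k i)) + (\<Sum>k=1..K. integral (I i) (H2 i k))"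
      if i: "i \<in> {1..K}" for i
    proof -
      have "((\<lambda>\<theta>. bdry i + \<Delta> i * J i \<theta> + (\<Sum>k=1..K. H1 k i \<theta>) + (\<Sum>k=1..K. H2 i k \<theta>)) has_integral
        \<Delta> i * bdry i + \<Delta> i * integral (I i) (J i) + (\<Sum>k=1..K. integral (I i) (H1 k i)) + (\<Sum>k=1..K. integral (I i) (H2 i k))) (I i)"
      proof (intro has_integral_add has_integral_sum has_integral_mult_right integrable_integral finite_atLeastAtMost)
        show "((\<lambda>\<theta>. bdry i) has_integral \<Delta> i * bdry i) (I i)"
          using has_integral_const_real[of "bdry i" "- \<tau> i" "- \<tau> (i - 1)"] step[OF i]
          by (simp add: I_def \<Delta>_def)
      qed (auto simp: I_def intro!: integrable_continuous_interval cont)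
      then have "((\<lambda>\<theta>. eval1 (ghat i) (Y \<theta>) \<theta>) has_integral
        \<Delta> i * bdry i + \<Delta> i * integral (I i) (J i) + (\<Sum>k=1..K. integral (I i) (H1 k i)) + (\<Sum>k=1..K. integral (I i) (H2 i k))) (I i)"
        by (rule has_integral_eq[rotated]) (simp add: ghat_eq[OF i])
      then show ?thesis by (simp add: integral_unique distrib_left)
    qed
    have d1: "((\<lambda>s. integral (I i) (\<lambda>\<theta>. eval1 (g i) (two_args (y (s + 0)) (y (s + \<theta>))) \<theta>)) has_real_derivative
        bdry i + integral (I i) (J i)) (at t within {0..})" if "i \<in> {1..K}" for i
      using separated.single_integral_has_derivative[OF separated_eval2 y _ y', of "- \<tau> i" "- \<tau> (i - 1)" "g i" 0]
        step[OF that] unfolding I_def J_def bdry_def by simp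
    have d2: "((\<lambda>s. integral (I i) (\<lambda>\<theta>. integral (I j) (\<lambda>\<omega>. eval2 (h i j) (two_args (y (s + \<theta>)) (y (s + \<omega>))) \<theta> \<omega>)))
        has_real_derivative integral (I j) (H1 i j) + integral (I i) (H2 i j) - HH i j) (at t within {0..})"
      if ij: "i \<in> {1..K}" "j \<in> {1..K}" for i j
    proof -
      have HH: "HH i j = integral (I i) (\<lambda>\<theta>. integral (I j) (\<lambda>\<omega>.
          deriv (\<lambda>s. eval2 (h i j) (two_args (y (t + \<theta>)) (y (t + \<omega>))) s \<omega>) \<theta>
          + deriv (\<lambda>s. eval2 (h i j) (two_args (y (t + \<theta>)) (y (t + \<omega>))) \<theta> s) \<omega>))"
        unfolding HH_def by (intro integral_cong hhat_rel[OF ij, unfolded I])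
      show ?thesis
        unfolding HH unfolding I_def H1_def H2_def
        using has_field_derivative_at_within[OF separated.double_integral_has_derivative[OF separated_eval2 y,
            of "- \<tau> i" "- \<tau> (i - 1)" "- \<tau> j" "- \<tau> (j - 1)" "h i j" t]] step[OF ij(1)] step[OF ij(2)]
        by (simp only: add_uminus_conv_diff neg_le_iff_le)
    qed
    have deriv_V: "((\<lambda>s. V (\<lambda>\<theta>. y (s + \<theta>))) has_real_derivative
        (\<Sum>i=1..K. \<Delta> i * (bdry i + integral (I i) (J i)))
        + (\<Sum>i=1..K. \<Sum>j=1..K. integral (I j) (H1 i j) + integral (I i) (H2 i j) - HH i j)) (at t within {0..})"
      unfolding V_def I by (intro DERIV_add DERIV_sum DERIV_cmult d1 d2)
    let ?D = "(\<Sum>i=1..K. \<Delta> i * (bdry i + integral (I i) (J i)))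
        + (\<Sum>i=1..K. \<Sum>j=1..K. integral (I j) (H1 i j) + integral (I i) (H2 i j) - HH i j)"
    have "?D = (\<Sum>i=1..K. integral (I i) (\<lambda>\<theta>. eval1 (ghat i) (Y \<theta>) \<theta>)) - (\<Sum>i=1..K. \<Sum>j=1..K. HH i j)"
    proof -
      \<comment> \<open>A double integral over \<open>I i\<close> and \<open>I j\<close> has boundary terms in both time variables; \<open>ghat\<^sub>i\<close> collects
        those that remain to be integrated over \<open>I i\<close>.\<close>
      have "(\<Sum>i=1..K. \<Sum>j=1..K. integral (I j) (H1 i j)) = (\<Sum>i=1..K. \<Sum>k=1..K. integral (I i) (H1 k i))"
        by (rule sum.swap)
      then show ?thesis
        by (simp add: ghat_int sum.distrib sum_subtractf)
    qed
    also have "\<dots> \<le> - c * (norm (x t))\<^sup>2"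
    proof -
      have ev: "eval1 (- ghat i) X \<theta> = - eval1 (ghat i) X \<theta>" for i X \<theta>
        by (simp add: eval2_def rpoly_eval_uminus)
      have "\<alpha>3 * \<tau> K * (norm (y (t - \<tau> (1 - 1))))\<^sup>2 \<le>
         (\<Sum>i=1..K. integral (I i) (\<lambda>\<theta>. eval1 (- ghat i) (Y \<theta>) \<theta>))"
        unfolding I[symmetric]
      proof (rule \<alpha>3(2)[where x = "\<lambda>k. y (t - \<tau> (k - 1))"])
        show "Y \<theta> k = y (t - \<tau> (k - 1))" if "1 \<le> k" "k \<le> K + 1" for \<theta> k
          using that by (simp add: Y_def)
        show "(\<lambda>\<theta>. eval1 (- ghat i) (Y \<theta>) \<theta>) integrable_on delay_interval \<tau> i" if "i \<in> {1..K}" for i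
          unfolding ev I using ghat_cont[OF that] unfolding I_def
          by (intro integrable_continuous_interval continuous_intros)
      qed
      also have "\<dots> = - (\<Sum>i=1..K. integral (I i) (\<lambda>\<theta>. eval1 (ghat i) (Y \<theta>) \<theta>))"
        by (simp add: ev sum_negf)
      finally have 1: "\<alpha>3 * \<tau> K * (norm (x t))\<^sup>2 \<le> - (\<Sum>i=1..K. integral (I i) (\<lambda>\<theta>. eval1 (ghat i) (Y \<theta>) \<theta>))"
        using t \<tau>K \<tau>0 by (simp add: yx)
      have 2: "(\<Sum>i=1..K. \<Sum>j=1..K. HH i j) \<ge> 0"
        unfolding HH_def I[symmetric] by (rule Xi2_double_integral_nonneg[OF assms(10) shift])
      have "c * (norm (x t))\<^sup>2 \<le> \<alpha>3 * \<tau> K * (norm (x t))\<^sup>2" by (rule c) simp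
      with 1 2 show ?thesis by simp
    qed
    finally have D: "?D \<le> - c * (norm (x t))\<^sup>2" .
    have "((\<lambda>s. V (\<lambda>\<theta>. x (s + \<theta>))) has_real_derivative ?D) (at t within {0..})"
      by (rule has_field_derivative_transform_within[OF deriv_V zero_less_one]) (use t V_y in auto)
    with D show "\<exists>D. ((\<lambda>s. V (\<lambda>\<theta>. x (s + \<theta>))) has_real_derivative D) (at t within {0..})
        \<and> D \<le> - c * (norm (x t))\<^sup>2" by blast
  qed
  then show ?thesis
    by (rule lyapunov_krasovskii.global_asymptotic_stability)
qed

end
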